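(* Let $R$ and $\tilde R$ be normal Noetherian domains, and let $(\mathcal C,R)$ and $(\tilde{\mathcal C},\tilde R)$ be cluster structures of geometric type in $R$ and $\tilde R$ with fixed initial extended clusters $\mathbf x_0$ and $\tilde{\mathbf x}_0$. Assume the following: 1) there is a marker $\kappa$ that makes $(\mathcal C,\tilde{\mathcal C},\kappa)$ a related triple, along with a birational quasi-isomorphism $\mathcal Q:(\mathcal C,R)\to(\tilde{\mathcal C},\tilde R)$; 2) the initial extended cluster $\tilde{\mathbf x}_0$ is admissible; 3) the set of marked variables $\mathbf x_0(\kappa)$ is admissible; 4) the initial extended cluster $\mathbf x_0$ is regular; 5) each nonmarked cluster variable in $\mathbf x_0$ is coprime with each marked variable (i.e. with each element of $\mathbf x_0(\kappa)$). Then $\mathbf x_0$ is admissible, $\bar{\mathcal A}(\tilde{\mathcal C})\subseteq\tilde R$ and $\bar{\mathcal A}(\mathcal C)\subseteq R$.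
   Context: Rings are commutative with $1$; $[a,b]=\{a,a+1,\dots,b\}$. Cluster structures. Let $\mathcal F$ be a field of rational functions in $N+M$ variables over $\mathbb Q$. An extended seed is a pair $\Sigma=(\mathbf x,B)$, where $\mathbf x=(x_1,\dots,x_{N+M})$ is a tuple of elements of $\mathcal F$ with $\mathcal F=\mathbb Q(x_1,\dots,x_{N+M})$ (the extended cluster), and $B=(b_{ij})$, $i\in[1,N]$, $j\in[1,N+M]$, is an integer matrix (the exchange matrix) whose first $N$ columns form a skew-symmetrizable matrix $B^{[1,N]}$ (there is a diagonal matrix $D$ with positive diagonal entries such that $DB^{[1,N]}$ is skew-symmetric). $x_1,\dots,x_N$ are cluster variables, $x_{N+1},\dots,x_{N+M}$ are frozen variables. The mutation of $\Sigma$ in direction $k\in[1,N]$ is the extended seed $((\mathbf x\setminus\{x_k\})\cup\{x_k'\},B')$ with $x_kx_k'=\prod_{b_{kj}>0}x_j^{b_{kj}}+\prod_{b_{kj}<0}x_j^{-b_{kj}}$, and $b'_{ij}=-b_{ij}$ if $i=k$ or $j=k$, $b'_{ij}=b_{ij}+\frac12(|b_{ik}|b_{kj}+b_{ik}|b_{kj}|)$ otherwise. The element $x_k'$ is the mutation of $x_k$. The collection $\mathcal C$ of all extended seeds obtained from an initial extended seed $\Sigma_0=(\mathbf x_0,B_0)$ by finite sequences of mutations is a cluster structure of geometric type of rank $N$, with ambient field $\mathcal F=\mathcal F_{\mathcal C}$. For an extended cluster $\mathbf x$, $\mathcal A(\mathbf x)=\mathbb Z[x_1,\dots,x_{N+M}]$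 and $\mathcal L(\mathbf x)=\mathbb Z[x_1^{\pm1},\dots,x_N^{\pm1},x_{N+1},\dots,x_{N+M}]$. The upper cluster algebra is $\bar{\mathcal A}(\mathcal C)=\bigcap_{\mathbf x\in\mathcal C}\mathcal L(\mathbf x)$ (over all extended clusters of $\mathcal C$). A cluster structure in an integral domain $R$ is a cluster structure $\mathcal C$ with an embedding $\mathcal A(\mathbf x_0)\hookrightarrow\operatorname{Frac}R$; then $\mathcal F_{\mathcal C}$ is identified with a subfield of $\operatorname{Frac}R$. A variable is regular if it lies in $R$; a set of variables (in particular an extended cluster) is regular if all its elements are. Algebra. A domain is normal if it is integrally closed in its fraction field. Two elements of $R$ are coprime if no prime ideal of $R$ of height $1$ contains both. Related triples. Let $\mathcal C$ (rank $N$, $M$ frozen variables) and $\tilde{\mathcal C}$ (rank $\tilde N$, $\tilde M$ frozen variables) be cluster structures with $\tilde N<N$, $N+M=\tilde N+\tilde M$, and fixed initial extended seeds $(\mathbf x_0,B_0)$, $(\tilde{\mathbf x}_0,\tilde B_0)$, $\mathbf x_0=(x_1,\dots,x_{N+M})$, $\tilde{\mathbf x}_0=(\tilde x_1,\dots,\tilde x_{N+M})$. A marker is a bijection $\kappa:[1,N+M]\to[1,N+M]$ with $\kappa([N+1,N+M])\subset[\tilde N+1,\tilde N+\tilde M]$; then $(\mathcal C,\tilde{\mathcal C},\kappa)$ is called a related triple. Put $\tilde{\mathcal I}(\kappa)=[\tilde N+1,\tilde N+\tilde M]\cap\kappa([1,N])$ and $\mathcal I(\kappa)=\kappa^{-1}(\tilde{\mathcal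 I}(\kappa))\subseteq[1,N]$. The marked variables are $\mathbf x_0(\kappa)=\{x_i\in\mathbf x_0: i\in\mathcal I(\kappa)\}$ in $\mathcal C$ and $\tilde{\mathbf x}_0(\kappa)=\{\tilde x_i\in\tilde{\mathbf x}_0: i\in\tilde{\mathcal I}(\kappa)\}$ in $\tilde{\mathcal C}$; other variables are nonmarked. An extended seed (and its extended cluster) of $\mathcal C$ is marked if it is obtained from the initial one by mutations in directions $i_1,\dots,i_m\in[1,N]\setminus\mathcal I(\kappa)$; the extended seed of $\tilde{\mathcal C}$ obtained from the initial one by mutations in directions $\kappa(i_1),\dots,\kappa(i_m)$ is related to it, and the variables $x_i\in\mathbf x$ and $\tilde x_{\kappa(i)}\in\tilde{\mathbf x}$ of related extended clusters $\mathbf x,\tilde{\mathbf x}$ are related. Quasi-isomorphisms. A quasi-isomorphism $\mathcal Q:\mathcal C\to\tilde{\mathcal C}$ is a field isomorphism $\mathcal Q:\mathcal F_{\mathcal C}\to\mathcal F_{\tilde{\mathcal C}}$ such that for every extended marked cluster $\mathbf x$ with related extended cluster $\tilde{\mathbf x}$ there are integers $\lambda_{ij}$ ($i\in[1,N+M]$, $j\in\mathcal I(\kappa)$) with $\mathcal Q(x_i)=\tilde x_{\kappa(i)}\prod_{j\in\mathcal I(\kappa)}\tilde x_{\kappa(j)}^{\lambda_{ij}}$ for $i\notin\mathcal I(\kappa)$ and $\mathcal Q(x_i)=\prod_{j\in\mathcal I(\kappa)}\tilde x_{\kappa(j)}^{\lambda_{ij}}$ for $i\in\mathcal I(\kappa)$.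 If $\mathcal C,\tilde{\mathcal C}$ are cluster structures in normal Noetherian domains $R,\tilde R$, then $\mathcal Q$ is birational if the marked variables $\mathbf x_0(\kappa)$, $\tilde{\mathbf x}_0(\kappa)$ are regular and the isomorphism $\mathcal Q:\mathcal A(\mathbf x_0)[\mathbf x_0(\kappa)^{\pm1}]\to\mathcal A(\tilde{\mathbf x}_0)[\tilde{\mathbf x}_0(\kappa)^{\pm1}]$ extends to a ring isomorphism $R[\mathbf x_0(\kappa)^{\pm1}]\to\tilde R[\tilde{\mathbf x}_0(\kappa)^{\pm1}]$ (i.e. there is such a ring isomorphism whose induced isomorphism of fraction fields restricts to $\mathcal Q$ on $\mathcal F_{\mathcal C}$), where $[\,\cdot^{\pm1}]$ denotes localization at all the listed elements. Admissibility. A subset $A\subseteq\mathbf x_0$ of initial variables is admissible if: all variables in $A$ are regular; all cluster variables in $A$ are pairwise coprime; for each cluster variable $x\in A$, its mutation $x'$ (from the initial extended seed) is regular and coprime with $x$. Likewise for subsets of $\tilde{\mathbf x}_0$ in $(\tilde{\mathcal C},\tilde R)$. *)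

theory Defs
  imports
    "HOL-Algebra.Algebraic_Closure_Type"
    "HOL-Algebra.Generated_Fields"
    "HOL-Algebra.Ring_Divisibility"
    "HOL-Algebra.QuotRing"
    "HOL-Computational_Algebra.Polynomial_Factorial"
    "HOL-Library.Poly_Mapping"
    "HOL-Library.Extended_Nat"
begin

text \<open>
  Integral domains are types of class \<^class>\<open>idom\<close> and the fraction field of \<open>'r\<close> is \<open>'r fract\<close>,
  with \<open>'r\<close> embedded by \<^const>\<open>to_fract\<close>. The locale-based notions of HOL-Algebra are applied to
  \<^const>\<open>ring_of_type_algebra\<close>, the type class operations packed as a ring record.
\<close>

abbreviation as_ring :: "'a::ring_1 ring"
  where "as_ring \<equiv> ring_of_type_algebra"

abbreviation as_subring :: "'a::ring_1 set \<Rightarrow> 'a ring"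
  where "as_subring S \<equiv> as_ring\<lparr>carrier := S\<rparr>"


section \<open>Commutative algebra\<close>

definition normal_domain :: "'r::idom itself \<Rightarrow> bool"
  where "normal_domain T \<longleftrightarrow>
    (\<forall>x :: 'r fract. (\<exists>p :: 'r poly. lead_coeff p = 1 \<and> poly (map_poly to_fract p) x = 0)
       \<longrightarrow> x \<in> range to_fract)"

definition prime_height :: "('a, 'm) ring_scheme \<Rightarrow> 'a set \<Rightarrow> enat"
  where "prime_height R P =
    (SUP n \<in> {n. \<exists>Q :: nat \<Rightarrow> 'a set.
        (\<forall>i\<le>n. primeideal (Q i) R) \<and> (\<forall>i<n. Q i \<subset> Q (Suc i)) \<and> Q n = P}. enat n)"

definition coprime_elems :: "('a, 'm) ring_scheme \<Rightarrow> 'a \<Rightarrow> 'a \<Rightarrow> bool"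
  where "coprime_elems R a b \<longleftrightarrow>
    \<not> (\<exists>P. primeideal P R \<and> prime_height R P = 1 \<and> a \<in> P \<and> b \<in> P)"

definition regular :: "'r::idom fract \<Rightarrow> bool"
  where "regular x \<longleftrightarrow> x \<in> range to_fract"

definition coprime_regular :: "'r::idom fract \<Rightarrow> 'r fract \<Rightarrow> bool"
  where "coprime_regular x y \<longleftrightarrow>
    (\<exists>a b. x = to_fract a \<and> y = to_fract b \<and> coprime_elems as_ring a b)"

text \<open>Localization of the subring \<open>A\<close> of a field at the (nonzero) elements of \<open>S \<subseteq> A\<close>.\<close>

definition localize :: "'k::field set \<Rightarrow> 'k set \<Rightarrow> 'k set"
  where "localize A S = generate_ring as_ring (A \<union> inverse ` S)"

text \<open>
  Polynomials over the integers in variables indexed by \<^typ>\<open>nat\<close> are represented as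
  \<open>(nat \<Rightarrow>\<^sub>0 nat) \<Rightarrow>\<^sub>0 int\<close>: a finitely supported family of coefficients indexed by
  exponent vectors.
\<close>

definition int_poly_eval :: "(nat \<Rightarrow> 'k::field) \<Rightarrow> ((nat \<Rightarrow>\<^sub>0 nat) \<Rightarrow>\<^sub>0 int) \<Rightarrow> 'k"
  where "int_poly_eval x p =
    (\<Sum>m \<in> Poly_Mapping.keys p. of_int (Poly_Mapping.lookup p m) *
      (\<Prod>i \<in> Poly_Mapping.keys m. x i ^ Poly_Mapping.lookup m i))"

text \<open>
  Injectivity of the evaluation map from the integer polynomial ring in the variables
  \<open>I\<close>. It forces characteristic \<open>0\<close>, so (clearing denominators) it is algebraic
  independence over the rationals.
\<close>

definition alg_independent :: "nat set \<Rightarrow> (nat \<Rightarrow> 'k::field) \<Rightarrow> bool"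
  where "alg_independent I x \<longleftrightarrow>
    (\<forall>p. (\<forall>m \<in> Poly_Mapping.keys p. Poly_Mapping.keys m \<subseteq> I) \<longrightarrow> int_poly_eval x p = 0 \<longrightarrow> p = 0)"


section \<open>Cluster structures\<close>

text \<open>
  Tuples and matrices are functions on \<^typ>\<open>nat\<close> of which only the values at indices in
  \<open>{1..N}\<close>, \<open>{1..N + M}\<close> matter.
\<close>

record 'k ext_seed =
  vars :: "nat \<Rightarrow> 'k"
  mat :: "nat \<Rightarrow> nat \<Rightarrow> int"

record 'k cluster_str =
  rk :: nat
  nfrozen :: nat
  init :: "'k ext_seed"

abbreviation nvars :: "'k cluster_str \<Rightarrow> nat"
  where "nvars C \<equiv> rk C + nfrozen C"

definition skew_symmetrizable :: "nat \<Rightarrow> (nat \<Rightarrow> nat \<Rightarrow> int) \<Rightarrow> bool"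
  where "skew_symmetrizable N B \<longleftrightarrow>
    (\<exists>d :: nat \<Rightarrow> real. (\<forall>i \<in> {1..N}. d i > 0) \<and>
      (\<forall>i \<in> {1..N}. \<forall>j \<in> {1..N}. d i * of_int (B i j) = - (d j * of_int (B j i))))"

text \<open>
  The ambient field, as a subfield of the field \<open>'k\<close> into which it is embedded.
\<close>

definition ambient_field :: "'k::field cluster_str \<Rightarrow> 'k set"
  where "ambient_field C = generate_field as_ring (vars (init C) ` {1..nvars C})"

text \<open>
  An ambient field of rational functions over the rationals in \<open>N + M\<close> variables has
  transcendence degree \<open>N + M\<close>, so its generators \<open>vars (init C) i\<close> are
  algebraically independent. Conversely, given a cluster structure with an embedding of the
  integer polynomial ring in the initial variables into \<open>'k\<close>, the images of these variables are
  algebraically independent. Thus, for \<open>'k\<close> a type \<open>'r fract\<close>, the following says that \<open>C\<close> is a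
  cluster structure in the domain \<open>'r\<close>, with its ambient field identified with a subfield of the
  fraction field.
\<close>

definition cluster_structure :: "'k::field cluster_str \<Rightarrow> bool"
  where "cluster_structure C \<longleftrightarrow>
    alg_independent {1..nvars C} (vars (init C)) \<and> skew_symmetrizable (rk C) (mat (init C))"

text \<open>In a field, \<open>mutated_var n \<Sigma> k\<close> is the unique \<open>x'\<close> satisfying the exchange relation for
  \<open>x\<^sub>k x'\<close>, because \<open>x\<^sub>k \<noteq> 0\<close>.\<close>

definition mutated_var :: "nat \<Rightarrow> 'k::field ext_seed \<Rightarrow> nat \<Rightarrow> 'k"
  where "mutated_var n \<Sigma> k =
    ((\<Prod>j \<in> {j \<in> {1..n}. mat \<Sigma> k j > 0}. vars \<Sigma> j ^ nat (mat \<Sigma> k j)) +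
     (\<Prod>j \<in> {j \<in> {1..n}. mat \<Sigma> k j < 0}. vars \<Sigma> j ^ nat (- mat \<Sigma> k j))) / vars \<Sigma> k"

text \<open>The division by \<open>2\<close> is exact.\<close>

definition mutated_mat :: "(nat \<Rightarrow> nat \<Rightarrow> int) \<Rightarrow> nat \<Rightarrow> nat \<Rightarrow> nat \<Rightarrow> int"
  where "mutated_mat B k i j =
    (if i = k \<or> j = k then - B i j
     else B i j + (\<bar>B i k\<bar> * B k j + B i k * \<bar>B k j\<bar>) div 2)"

definition mutation :: "nat \<Rightarrow> nat \<Rightarrow> 'k::field ext_seed \<Rightarrow> 'k ext_seed"
  where "mutation n k \<Sigma> =
    \<lparr>vars = (vars \<Sigma>)(k := mutated_var n \<Sigma> k), mat = mutated_mat (mat \<Sigma>) k\<rparr>"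

inductive_set seeds :: "'k::field cluster_str \<Rightarrow> 'k ext_seed set"
  for C
  where
    init: "init C \<in> seeds C"
  | mutate: "\<Sigma> \<in> seeds C \<Longrightarrow> k \<in> {1..rk C} \<Longrightarrow> mutation (nvars C) k \<Sigma> \<in> seeds C"

definition laurent_ring :: "'k::field cluster_str \<Rightarrow> (nat \<Rightarrow> 'k) \<Rightarrow> 'k set"
  where "laurent_ring C x =
    generate_ring as_ring (x ` {1..nvars C} \<union> (\<lambda>i. inverse (x i)) ` {1..rk C})"

definition upper_cluster_algebra :: "'k::field cluster_str \<Rightarrow> 'k set"
  where "upper_cluster_algebra C = (\<Inter>\<Sigma> \<in> seeds C. laurent_ring C (vars \<Sigma>))"

definition init_ext_cluster :: "'k cluster_str \<Rightarrow> 'k set"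
  where "init_ext_cluster C = vars (init C) ` {1..nvars C}"

definition init_cluster_vars :: "'k cluster_str \<Rightarrow> 'k set"
  where "init_cluster_vars C = vars (init C) ` {1..rk C}"

definition admissible :: "'r::idom fract cluster_str \<Rightarrow> 'r fract set \<Rightarrow> bool"
  where "admissible C A \<longleftrightarrow>
    A \<subseteq> init_ext_cluster C \<and>
    (\<forall>x \<in> A. regular x) \<and>
    (\<forall>x \<in> A \<inter> init_cluster_vars C. \<forall>y \<in> A \<inter> init_cluster_vars C.
        x \<noteq> y \<longrightarrow> coprime_regular x y) \<and>
    (\<forall>i \<in> {1..rk C}. vars (init C) i \<in> A \<longrightarrow>
        regular (mutated_var (nvars C) (init C) i) \<and>
        coprime_regular (mutated_var (nvars C) (init C) i) (vars (init C) i))"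


section \<open>Related triples and quasi-isomorphisms\<close>

definition related_triple :: "'k::field cluster_str \<Rightarrow> 'l::field cluster_str \<Rightarrow> (nat \<Rightarrow> nat) \<Rightarrow> bool"
  where "related_triple C C' \<kappa> \<longleftrightarrow>
    rk C' < rk C \<and> nvars C = nvars C' \<and>
    bij_betw \<kappa> {1..nvars C} {1..nvars C} \<and>
    \<kappa> ` {rk C + 1..nvars C} \<subseteq> {rk C' + 1..nvars C'}"

definition marked_indices' :: "'k cluster_str \<Rightarrow> 'l cluster_str \<Rightarrow> (nat \<Rightarrow> nat) \<Rightarrow> nat set"
  where "marked_indices' C C' \<kappa> = {rk C' + 1..nvars C'} \<inter> \<kappa> ` {1..rk C}"

definition marked_indices :: "'k cluster_str \<Rightarrow> 'l cluster_str \<Rightarrow> (nat \<Rightarrow> nat) \<Rightarrow> nat set"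
  where "marked_indices C C' \<kappa> = {i \<in> {1..nvars C}. \<kappa> i \<in> marked_indices' C C' \<kappa>}"

definition marked_vars :: "'k cluster_str \<Rightarrow> 'l cluster_str \<Rightarrow> (nat \<Rightarrow> nat) \<Rightarrow> 'k set"
  where "marked_vars C C' \<kappa> = vars (init C) ` marked_indices C C' \<kappa>"

definition marked_vars' :: "'k cluster_str \<Rightarrow> 'l cluster_str \<Rightarrow> (nat \<Rightarrow> nat) \<Rightarrow> 'l set"
  where "marked_vars' C C' \<kappa> = vars (init C') ` marked_indices' C C' \<kappa>"

text \<open>\<open>related_seeds C C' \<kappa> \<Sigma> \<Sigma>'\<close>: \<open>\<Sigma>\<close> is a marked extended seed of \<open>C\<close> and \<open>\<Sigma>'\<close> is the extended
  seed of \<open>C'\<close> related to it.\<close>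

inductive related_seeds ::
  "'k::field cluster_str \<Rightarrow> 'l::field cluster_str \<Rightarrow> (nat \<Rightarrow> nat) \<Rightarrow> 'k ext_seed \<Rightarrow> 'l ext_seed \<Rightarrow> bool"
  for C C' \<kappa>
  where
    init: "related_seeds C C' \<kappa> (init C) (init C')"
  | mutate: "related_seeds C C' \<kappa> \<Sigma> \<Sigma>' \<Longrightarrow> i \<in> {1..rk C} - marked_indices C C' \<kappa> \<Longrightarrow>
      related_seeds C C' \<kappa> (mutation (nvars C) i \<Sigma>) (mutation (nvars C') (\<kappa> i) \<Sigma>')"

definition quasi_isomorphism ::
  "'k::field cluster_str \<Rightarrow> 'l::field cluster_str \<Rightarrow> (nat \<Rightarrow> nat) \<Rightarrow> ('k \<Rightarrow> 'l) \<Rightarrow> bool"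
  where "quasi_isomorphism C C' \<kappa> Q \<longleftrightarrow>
    Q \<in> ring_iso (as_subring (ambient_field C)) (as_subring (ambient_field C')) \<and>
    (\<forall>\<Sigma> \<Sigma>'. related_seeds C C' \<kappa> \<Sigma> \<Sigma>' \<longrightarrow>
      (\<exists>l :: nat \<Rightarrow> nat \<Rightarrow> int. \<forall>i \<in> {1..nvars C}.
        Q (vars \<Sigma> i) =
          (if i \<in> marked_indices C C' \<kappa> then 1 else vars \<Sigma>' (\<kappa> i)) *
          (\<Prod>j \<in> marked_indices C C' \<kappa>. vars \<Sigma>' (\<kappa> j) powi l i j)))"

text \<open>\<open>\<phi>\<close> is the ring isomorphism between the localizations and \<open>\<psi>\<close> the (unique) isomorphism it
  induces between the fraction fields. The initial variables need not all be regular, so the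
  localized polynomial ring on which \<open>Q\<close> is given need not lie in the domain of \<open>\<phi>\<close>; hence the
  detour through \<open>\<psi>\<close>.\<close>

definition birational ::
  "'r::idom fract cluster_str \<Rightarrow> 's::idom fract cluster_str \<Rightarrow> (nat \<Rightarrow> nat) \<Rightarrow>
   ('r fract \<Rightarrow> 's fract) \<Rightarrow> bool"
  where "birational C C' \<kappa> Q \<longleftrightarrow>
    (\<forall>x \<in> marked_vars C C' \<kappa>. regular x) \<and> (\<forall>x \<in> marked_vars' C C' \<kappa>. regular x) \<and>
    (\<exists>\<phi> \<psi>.
      \<phi> \<in> ring_iso (as_subring (localize (range to_fract) (marked_vars C C' \<kappa>)))
                    (as_subring (localize (range to_fract) (marked_vars' C C' \<kappa>))) \<and>
      \<psi> \<in> ring_iso (as_ring :: 'r fract ring) (as_ring :: 's fract ring) \<and>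
      (\<forall>a \<in> localize (range to_fract) (marked_vars C C' \<kappa>). \<psi> a = \<phi> a) \<and>
      (\<forall>a \<in> ambient_field C. \<psi> a = Q a))"

end

theory Submission
  imports Defs
begin

text \<open>
  In a normal Noetherian domain \<open>R\<close>, two elements \<open>a\<close>, \<open>b\<close>, not both zero, have no common prime of
  height \<open>1\<close> if and only if every fraction \<open>y\<close> with \<open>a y \<in> R\<close> and \<open>b y \<in> R\<close> lies in \<open>R\<close>. The latter
  condition makes sense for any subring \<open>S\<close> of the fraction field in place of \<open>R\<close>. It is stable
  under multiplying \<open>a\<close> and \<open>b\<close> by units of \<open>S\<close>, it passes from \<open>R\<close> to its localizations, and it
  comes back from the localization at a set \<open>M\<close> of elements that are all coprime to \<open>a\<close>.

  The birational quasi-isomorphism identifies the localizations of the two domains at the marked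
  variables, and maps a nonmarked variable \<open>x\<close> of \<open>C\<close> and its mutation \<open>x'\<close> to the corresponding
  elements for \<open>C'\<close> up to units. Hence the coprimality conditions for nonmarked variables are
  pulled back from \<open>C'\<close> to the localization of \<open>R\<close>, and from there to \<open>R\<close>; the regularity of \<open>x'\<close>
  follows in the same way, as \<open>x x' \<in> R\<close> and \<open>x\<close> is coprime to the marked variables.

  An element of the upper cluster algebra has a monomial in the initial cluster as a denominator. The
  powers of a variable \<open>x\<close> can be removed from it, because another denominator is a monomial in the
  cluster mutated at \<open>x\<close>, which is coprime to \<open>x\<close>.
\<close>

section \<open>Ideals and primes of height one\<close>

lemma as_ring_simps [simp]:
  "carrier (as_ring :: 'a::ring_1 ring) = UNIV"
  "monoid.mult (as_ring :: 'a::ring_1 ring) = (*)"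
  "one (as_ring :: 'a::ring_1 ring) = 1"
  "ring.zero (as_ring :: 'a::ring_1 ring) = 0"
  "add (as_ring :: 'a::ring_1 ring) = (+)"
  by (simp_all add: ring_of_type_algebra_def fun_eq_iff)

lemma a_inv_as_ring [simp]: "\<ominus>\<^bsub>as_ring\<^esub> x = - (x :: 'a::comm_ring_1)"
proof -
  interpret ring "as_ring :: 'a ring" by (rule ring_from_type_algebra)
  show ?thesis by (rule minus_equality) auto
qed

lemma m_inv_as_ring: "x \<noteq> 0 \<Longrightarrow> inv\<^bsub>as_ring\<^esub> x = inverse (x :: 'a::field)"
proof -
  assume "x \<noteq> 0"
  interpret cring "as_ring :: 'a ring" by (rule cring_from_type_algebra)
  show ?thesis by (rule comm_inv_char) (use \<open>x \<noteq> 0\<close> in auto)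
qed

lemma ideal_as_ring_iff:
  fixes I :: "'a::comm_ring_1 set"
  shows "ideal I as_ring \<longleftrightarrow>
    0 \<in> I \<and> (\<forall>x\<in>I. \<forall>y\<in>I. x + y \<in> I) \<and> (\<forall>x\<in>I. \<forall>r. r * x \<in> I)"
proof
  assume "ideal I as_ring"
  then interpret ideal I "as_ring :: 'a ring" .
  show "0 \<in> I \<and> (\<forall>x\<in>I. \<forall>y\<in>I. x + y \<in> I) \<and> (\<forall>x\<in>I. \<forall>r. r * x \<in> I)"
    using additive_subgroup.zero_closed[OF is_additive_subgroup]
      additive_subgroup.a_closed[OF is_additive_subgroup] I_l_closed by auto
next
  assume *: "0 \<in> I \<and> (\<forall>x\<in>I. \<forall>y\<in>I. x + y \<in> I) \<and> (\<forall>x\<in>I. \<forall>r. r * x \<in> I)"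
  have inv: "inv\<^bsub>add_monoid as_ring\<^esub> x \<in> I" if "x \<in> I" for x
    using * that a_inv_as_ring[of x] unfolding a_inv_def by (metis mult_minus1)
  show "ideal I as_ring"
  proof (rule idealI[OF ring_from_type_algebra])
    show "subgroup I (add_monoid as_ring)"
      by (rule subgroup.intro) (use * inv in auto)
  qed (use * in \<open>auto simp: mult.commute\<close>)
qed

lemma primeideal_as_ring_iff:
  fixes P :: "'a::comm_ring_1 set"
  shows "primeideal P as_ring \<longleftrightarrow>
    ideal P as_ring \<and> 1 \<notin> P \<and> (\<forall>x y. x * y \<in> P \<longrightarrow> x \<in> P \<or> y \<in> P)"
proof
  assume "primeideal P as_ring"
  then interpret primeideal P "as_ring :: 'a ring" .
  have "1 \<notin> P" using I_notcarr one_imp_carrier by auto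
  then show "ideal P as_ring \<and> 1 \<notin> P \<and> (\<forall>x y. x * y \<in> P \<longrightarrow> x \<in> P \<or> y \<in> P)"
    using is_ideal I_prime by auto
next
  assume *: "ideal P as_ring \<and> 1 \<notin> P \<and> (\<forall>x y. x * y \<in> P \<longrightarrow> x \<in> P \<or> y \<in> P)"
  show "primeideal P as_ring"
    by (rule primeidealI[OF _ cring_from_type_algebra]) (use * in auto)
qed

lemma primeideal_zero: "primeideal {0 :: 'a::idom} as_ring"
  by (auto simp: primeideal_as_ring_iff ideal_as_ring_iff)

text \<open>As \<open>{0}\<close> is the least prime of a domain, height 1 means minimality among
  the nonzero primes. All later arguments about height use this form instead of suprema over
  chains.\<close>

lemma prime_height_eq_1_iff:
  fixes P :: "'a::idom set"
  assumes P: "primeideal P as_ring"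
  shows "prime_height as_ring P = 1 \<longleftrightarrow>
    P \<noteq> {0} \<and> (\<forall>Q. primeideal Q as_ring \<longrightarrow> Q \<subset> P \<longrightarrow> Q = {0})"
    (is "?l \<longleftrightarrow> ?r")
proof -
  let ?ch = "\<lambda>n Q. (\<forall>i\<le>n. primeideal (Q i) as_ring) \<and> (\<forall>i<n. Q i \<subset> Q (Suc i)) \<and> Q n = P"
  have zero_sub: "{0} \<subseteq> Q" if "primeideal Q as_ring" for Q :: "'a set"
    using that by (auto simp: primeideal_as_ring_iff ideal_as_ring_iff)
  have ge: "enat n \<le> prime_height as_ring P" if "?ch n Q" for n Q
    unfolding prime_height_def by (rule SUP_upper) (use that in blast)
  show ?thesis
  proof
    assume h: ?l
    have "Q = {0}" if Q: "primeideal Q as_ring" "Q \<subset> P" for Q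
    proof (rule ccontr)
      assume "Q \<noteq> {0}"
      then have "?ch 2 (\<lambda>i. if i = 0 then {0} else if i = 1 then Q else P)"
        using zero_sub[OF Q(1)] Q P primeideal_zero by (auto simp: less_2_cases_iff)
      from ge[OF this] h show False by (simp add: one_enat_def)
    qed
    moreover have "P \<noteq> {0}"
    proof
      assume P0: "P = {0}"
      have "n = 0" if "?ch n Q" for n Q
      proof (rule ccontr)
        assume "n \<noteq> 0"
        then obtain m where "n = Suc m" by (cases n) auto
        then have "Q m \<subset> {0}" "primeideal (Q m) as_ring" using that P0 by auto
        with zero_sub[of "Q m"] show False by blast
      qed
      then have "prime_height as_ring P \<le> 0"
        unfolding prime_height_def by (intro SUP_least) (auto simp: zero_enat_def)
      with h show False by simp
    qed
    ultimately show ?r by blast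
  next
    assume r: ?r
    then have "?ch 1 (\<lambda>i. if i = 0 then {0} else P)"
      using P primeideal_zero zero_sub[OF P] by auto
    from ge[OF this] have "1 \<le> prime_height as_ring P" by (simp add: one_enat_def)
    moreover have "n \<le> 1" if "?ch n Q" for n Q
    proof (rule ccontr)
      assume "\<not> n \<le> 1"
      then obtain m where m: "n = Suc (Suc m)" by (metis One_nat_def le_SucI le_zero_eq not0_implies_Suc nat_le_linear)
      then have "Q m \<subset> Q (Suc m)" "Q (Suc m) \<subset> P" "primeideal (Q (Suc m)) as_ring"
        "primeideal (Q m) as_ring"
        using that by auto
      with r zero_sub[of "Q m"] show False by blast
    qed
    then have "prime_height as_ring P \<le> 1"
      unfolding prime_height_def by (intro SUP_least) (auto simp: one_enat_def)
    ultimately show ?l by simp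
  qed
qed

section \<open>Noetherian rings and almost integral elements\<close>

text \<open>Zorn's lemma applies because in a Noetherian ring the union of a chain of ideals belongs
  to the chain. Every later use of the Noetherian property goes through this maximal
  condition.\<close>

lemma (in noetherian_ring) ex_maximal_ideal_in:
  assumes "F \<noteq> {}" "\<And>I. I \<in> F \<Longrightarrow> ideal I R"
  shows "\<exists>M\<in>F. \<forall>I\<in>F. M \<subseteq> I \<longrightarrow> I = M"
proof (rule subset_Zorn_nonempty[OF assms(1)])
  fix C assume C: "C \<noteq> {}" "subset.chain F C"
  then have "subset.chain {I. ideal I R} C"
    using assms(2) by (auto simp: pred_on.chain_def)
  from ideal_chain_is_trivial[OF C(1) this] have "\<Union>C \<in> C" .
  then show "\<Union>C \<in> F" using C(2) by (auto simp: pred_on.chain_def)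
qed

text \<open>Let \<open>I n\<close> be the ideal generated by the first \<open>n\<close> terms. If
  \<open>I n\<close> is maximal among all these ideals, it equals \<open>I (Suc n)\<close>, which
  contains \<open>c n\<close>.\<close>

lemma noetherian_sequence:
  fixes c :: "nat \<Rightarrow> 'a::comm_ring_1"
  assumes "noetherian_ring (as_ring :: 'a ring)"
  shows "\<exists>n r. c n = (\<Sum>i<n. r i * c i)"
proof -
  define I where "I n = range (\<lambda>r. \<Sum>i<n. r i * c i)" for n
  have "ideal (I n) as_ring" for n
    unfolding ideal_as_ring_iff
  proof (intro conjI ballI allI)
    show "0 \<in> I n" unfolding I_def by (rule range_eqI[of _ _ "\<lambda>_. 0"]) simp
  next
    fix x y assume "x \<in> I n" "y \<in> I n"
    then obtain r s where "x = (\<Sum>i<n. r i * c i)" "y = (\<Sum>i<n. s i * c i)"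
      by (auto simp: I_def)
    then show "x + y \<in> I n" unfolding I_def
      by (intro range_eqI[of _ _ "\<lambda>i. r i + s i"]) (simp add: sum.distrib distrib_right)
  next
    fix x t assume "x \<in> I n"
    then obtain r where "x = (\<Sum>i<n. r i * c i)" by (auto simp: I_def)
    then show "t * x \<in> I n" unfolding I_def
      by (intro range_eqI[of _ _ "\<lambda>i. t * r i"]) (simp add: sum_distrib_left mult.assoc)
  qed
  then obtain n where n: "\<And>m. I n \<subseteq> I m \<Longrightarrow> I m = I n"
    using noetherian_ring.ex_maximal_ideal_in[OF assms, of "range I"] by auto
  have "I n \<subseteq> I (Suc n)"
  proof
    fix x assume "x \<in> I n"
    then obtain r where "x = (\<Sum>i<n. r i * c i)" by (auto simp: I_def)
    then show "x \<in> I (Suc n)" unfolding I_def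
      by (intro range_eqI[of _ _ "r(n := 0)"]) simp
  qed
  moreover have "c n \<in> I (Suc n)" unfolding I_def
    by (rule range_eqI[of _ _ "\<lambda>i. if i = n then 1 else 0"]) simp
  ultimately have "c n \<in> I n" using n by blast
  then show ?thesis by (auto simp: I_def)
qed

text \<open>
  The chain of ideals generated by \<open>q, q w, \<dots>, q w^n\<close> becomes stationary, which makes \<open>w\<close>
  integral.
\<close>

lemma normal_noetherian_almost_integral:
  fixes w :: "'r::idom fract"
  assumes "normal_domain TYPE('r)" "noetherian_ring (as_ring :: 'r ring)"
    and "q \<noteq> 0" "\<And>n. to_fract q * w ^ n \<in> range to_fract"
  shows "w \<in> range to_fract"
proof -
  have "\<forall>n. \<exists>c. to_fract c = to_fract q * w ^ n"
  proof
    show "\<exists>c. to_fract c = to_fract q * w ^ n" for n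
      using assms(4)[of n] by (elim imageE) (rule exI, erule sym)
  qed
  from choice[OF this] obtain c where c: "\<And>n. to_fract (c n) = to_fract q * w ^ n"
    by blast
  obtain n r where nr: "c n = (\<Sum>i<n. r i * c i)"
    using noetherian_sequence[OF assms(2)] by blast
  have "to_fract q * w ^ n = to_fract q * (\<Sum>i<n. to_fract (r i) * w ^ i)"
    using arg_cong[OF nr, of to_fract] by (simp add: c sum_distrib_left mult.left_commute)
  then have eq: "w ^ n = (\<Sum>i<n. to_fract (r i) * w ^ i)" using \<open>q \<noteq> 0\<close> by simp
  define p where "p = monom 1 n - (\<Sum>i<n. monom (r i) i)"
  have cf: "poly.coeff p m = (if m = n then 1 else if m < n then - r m else 0)" for m
    by (simp add: p_def coeff_sum)
  have "degree p = n"
    by (rule antisym[OF degree_le le_degree]) (simp_all add: cf)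
  have "poly (map_poly to_fract p) w = (\<Sum>i\<le>n. to_fract (poly.coeff p i) * w ^ i)"
    using \<open>degree p = n\<close> by (simp add: poly_altdef degree_map_poly coeff_map_poly)
  also have "\<dots> = (\<Sum>i<n. to_fract (poly.coeff p i) * w ^ i) + w ^ n"
    by (simp only: lessThan_Suc_atMost[symmetric] sum.lessThan_Suc cf) simp
  also have "(\<Sum>i<n. to_fract (poly.coeff p i) * w ^ i) = - (\<Sum>i<n. to_fract (r i) * w ^ i)"
    by (simp add: cf sum_negf)
  also have "\<dots> + w ^ n = 0" by (simp only: eq) simp
  finally have "poly (map_poly to_fract p) w = 0" .
  moreover have "lead_coeff p = 1" using \<open>degree p = n\<close> by (simp add: cf)
  ultimately show ?thesis using assms(1) unfolding normal_domain_def by blast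
qed

text \<open>Multiplication by \<open>w\<close> preserves \<open>J\<close>, so all
  \<open>q w^n\<close> stay in \<open>J\<close> and \<open>q\<close> is a common denominator of the
  powers of \<open>w\<close>.\<close>

lemma normal_noetherian_stable_ideal:
  fixes w :: "'r::idom fract"
  assumes "normal_domain TYPE('r)" "noetherian_ring (as_ring :: 'r ring)"
    and "q \<in> J" "q \<noteq> 0" "\<And>r. r \<in> J \<Longrightarrow> to_fract r * w \<in> to_fract ` J"
  shows "w \<in> range to_fract"
proof (rule normal_noetherian_almost_integral[OF assms(1,2,4)])
  fix n
  have "to_fract q * w ^ n \<in> to_fract ` J"
  proof (induction n)
    case (Suc n)
    then obtain r where r: "r \<in> J" "to_fract q * w ^ n = to_fract r" by auto
    have "to_fract q * w ^ Suc n = (to_fract q * w ^ n) * w" by (simp add: mult_ac)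
    then show ?case using assms(5)[OF r(1)] by (simp only: r(2))
  qed (use assms in auto)
  then show "to_fract q * w ^ n \<in> range to_fract" by auto
qed

section \<open>Ideals of denominators\<close>

text \<open>With \<open>K\<close> the fraction field of \<open>R\<close>, this is the annihilator of
  the class of \<open>w\<close> in the \<open>R\<close>-module \<open>K/R\<close>; it is a proper
  ideal exactly when \<open>w\<close> is not in \<open>R\<close>.\<close>

definition conductor :: "'r::idom fract \<Rightarrow> 'r set"
  where "conductor w = {r. to_fract r * w \<in> range to_fract}"

lemma range_to_fract_closed:
  "0 \<in> range to_fract" "1 \<in> range to_fract"
  "x \<in> range to_fract \<Longrightarrow> y \<in> range to_fract \<Longrightarrow> x + y \<in> range to_fract"
  "x \<in> range to_fract \<Longrightarrow> y \<in> range to_fract \<Longrightarrow> x * y \<in> range to_fract"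
  "x \<in> range to_fract \<Longrightarrow> - x \<in> range to_fract"
  using to_fract_0 to_fract_1 by (metis rangeI, metis rangeI)
    (auto simp flip: to_fract_add to_fract_mult to_fract_uminus)

lemma ideal_conductor: "ideal (conductor w) as_ring"
  unfolding ideal_as_ring_iff
proof (intro conjI ballI allI)
  show "0 \<in> conductor w" using range_to_fract_closed(1) by (simp add: conductor_def)
  show "x + y \<in> conductor w" if "x \<in> conductor w" "y \<in> conductor w" for x y
    using that range_to_fract_closed(3) by (simp add: conductor_def distrib_right)
  show "r * x \<in> conductor w" if "x \<in> conductor w" for r x
    using that range_to_fract_closed(4)[OF rangeI[of to_fract r]] by (simp add: conductor_def mult.assoc)
qed

lemma one_in_conductor_iff: "1 \<in> conductor w \<longleftrightarrow> w \<in> range to_fract"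
  by (simp add: conductor_def)

text \<open>A maximal annihilator is prime by the usual argument for associated primes: if
  \<open>s w\<close> is not in \<open>R\<close>, its conductor contains that of \<open>w\<close>,
  hence equals it. By normality \<open>w\<close> cannot preserve a nonzero ideal; this forces height
  1, since every prime strictly below would be preserved.\<close>

lemma maximal_conductor_height_one:
  fixes w :: "'r::idom fract"
  assumes "normal_domain TYPE('r)" "noetherian_ring (as_ring :: 'r ring)"
    and w: "w \<notin> range to_fract"
    and max: "\<And>v. v \<notin> range to_fract \<Longrightarrow> conductor w \<subseteq> conductor v \<Longrightarrow> conductor v = conductor w"
    and nz: "conductor w \<noteq> {0}"
  shows "primeideal (conductor w) as_ring" "prime_height as_ring (conductor w) = 1"
proof -
  let ?P = "conductor w"
  have P: "ideal ?P as_ring" by (rule ideal_conductor)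
  have prime: "r \<in> ?P" if rs: "r * s \<in> ?P" "s \<notin> ?P" for r s
  proof -
    have "to_fract s * w \<notin> range to_fract" using rs by (simp add: conductor_def)
    moreover have "?P \<subseteq> conductor (to_fract s * w)"
    proof
      fix x assume "x \<in> ?P"
      then have "to_fract x * w \<in> range to_fract" by (simp add: conductor_def)
      then have "to_fract s * (to_fract x * w) \<in> range to_fract"
        by (rule range_to_fract_closed(4)[OF rangeI])
      then show "x \<in> conductor (to_fract s * w)" by (simp add: conductor_def mult.left_commute)
    qed
    ultimately have "conductor (to_fract s * w) = ?P" by (rule max)
    moreover have "r \<in> conductor (to_fract s * w)" using rs by (simp add: conductor_def mult.assoc)
    ultimately show ?thesis by simp
  qed
  then show pr: "primeideal ?P as_ring"
    using P w unfolding primeideal_as_ring_iff one_in_conductor_iff by blast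
  have nonstable: "J = {0}"
    if J: "ideal J as_ring" "\<And>r. r \<in> J \<Longrightarrow> to_fract r * w \<in> to_fract ` J" for J
    using normal_noetherian_stable_ideal[OF assms(1,2) _ _ J(2)] w J(1)
    by (auto simp: ideal_as_ring_iff)
  \<comment> \<open>In the localization at \<open>?P\<close> the element \<open>u\<close> is a unit,
    so \<open>p\<close> generates the extension of \<open>?P\<close> there.\<close>
  obtain p u where p: "p \<in> ?P" "to_fract p * w = to_fract u" "u \<notin> ?P"
  proof -
    obtain p where "p \<in> ?P" "to_fract p * w \<notin> to_fract ` ?P"
      using nonstable[OF P] nz by blast
    then obtain u where "to_fract p * w = to_fract u" "u \<notin> ?P"
      by (auto simp: conductor_def)
    then show thesis using that \<open>p \<in> ?P\<close> by blast
  qed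
  \<comment> \<open>Since \<open>u q = p (q w)\<close> for \<open>q \<in> ?P\<close>, every smaller prime is stable under multiplication by \<open>w\<close>.\<close>
  have "Q = {0}" if Q: "primeideal Q as_ring" "Q \<subset> ?P" for Q
  proof (rule nonstable)
    show QI: "ideal Q as_ring" using Q by (simp add: primeideal_as_ring_iff)
    have Qprime: "x \<in> Q \<or> y \<in> Q" if "x * y \<in> Q" for x y
      using that Q by (auto simp: primeideal_as_ring_iff)
    have Qmult: "r * x \<in> Q" if "x \<in> Q" for r x
      using QI that by (simp add: ideal_as_ring_iff)
    have key: "u * q = p * v" if "to_fract q * w = to_fract v" for q v
    proof -
      have "to_fract (u * q) = to_fract (p * v)"
        by (simp add: p(2)[symmetric] that[symmetric] mult_ac)
      then show ?thesis by (simp del: to_fract_mult)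
    qed
    have "p \<notin> Q"
    proof
      assume "p \<in> Q"
      have "q \<in> Q" if q: "q \<in> ?P" for q
      proof -
        obtain v where "to_fract q * w = to_fract v" using q by (auto simp: conductor_def)
        then have "u * q = v * p" using key by (simp add: mult.commute)
        then have "u * q \<in> Q" using Qmult[OF \<open>p \<in> Q\<close>] by simp
        then show ?thesis using Qprime Q(2) p(3) by blast
      qed
      with Q(2) show False by blast
    qed
    fix q assume "q \<in> Q"
    then obtain v where v: "to_fract q * w = to_fract v" using Q(2) by (auto simp: conductor_def)
    then have "p * v \<in> Q" using key[OF v] Qmult[OF \<open>q \<in> Q\<close>, of u] by simp
    then have "v \<in> Q" using \<open>p \<notin> Q\<close> Qprime by blast
    then show "to_fract q * w \<in> to_fract ` Q" using v by simp
  qed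
  then show "prime_height as_ring ?P = 1"
    using nz by (simp add: prime_height_eq_1_iff[OF pr])
qed

section \<open>Coprimality\<close>

text \<open>For a subring \<open>S\<close> containing \<open>a\<close> and \<open>b\<close>, this
  says that the fractional ideal inverse to \<open>(a, b)\<close> is \<open>S\<close>
  itself.\<close>

definition coprime_in :: "'k::field set \<Rightarrow> 'k \<Rightarrow> 'k \<Rightarrow> bool"
  where "coprime_in S a b \<longleftrightarrow> (\<forall>y. a * y \<in> S \<longrightarrow> b * y \<in> S \<longrightarrow> y \<in> S)"

lemma coprime_in_commute: "coprime_in S a b \<longleftrightarrow> coprime_in S b a"
  by (auto simp: coprime_in_def)

text \<open>A fraction \<open>z\<close> violating the conclusion has both elements in its conductor.
  A maximal conductor above that one is a prime of height 1 containing both;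
  \<open>x \<noteq> 0\<close> ensures that it is not the zero ideal.\<close>

lemma coprime_regular_imp_coprime_in:
  fixes x y :: "'r::idom fract"
  assumes nn: "normal_domain TYPE('r)" "noetherian_ring (as_ring :: 'r ring)"
    and xy: "coprime_regular x y" and "x \<noteq> 0"
  shows "coprime_in (range to_fract) x y"
  unfolding coprime_in_def
proof (intro allI impI, rule ccontr)
  fix z assume z: "x * z \<in> range to_fract" "y * z \<in> range to_fract" "z \<notin> range to_fract"
  obtain a b where ab: "x = to_fract a" "y = to_fract b" "coprime_elems as_ring a b"
    using xy by (auto simp: coprime_regular_def)
  define F where "F = {conductor w | w. w \<notin> range to_fract \<and> conductor z \<subseteq> conductor w}"
  have "conductor z \<in> F" using z by (auto simp: F_def)
  then obtain w where w: "w \<notin> range to_fract" "conductor z \<subseteq> conductor w"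
    and max: "\<And>v. v \<notin> range to_fract \<Longrightarrow> conductor w \<subseteq> conductor v \<Longrightarrow> conductor v = conductor w"
  proof -
    have "\<exists>M\<in>F. \<forall>I\<in>F. M \<subseteq> I \<longrightarrow> I = M"
      using \<open>conductor z \<in> F\<close> ideal_conductor
      by (intro noetherian_ring.ex_maximal_ideal_in[OF nn(2)]) (blast, auto simp: F_def)
    then obtain w where w: "w \<notin> range to_fract" "conductor z \<subseteq> conductor w"
      and max: "\<forall>I\<in>F. conductor w \<subseteq> I \<longrightarrow> I = conductor w"
      unfolding F_def by blast
    \<comment> \<open>\<open>F\<close> is closed under passing to larger proper conductors, so
      maximality within \<open>F\<close> is maximality among all of them.\<close>
    have "conductor v \<in> F" if "v \<notin> range to_fract" "conductor w \<subseteq> conductor v" for v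
      using that w(2) unfolding F_def by blast
    with max show thesis by (intro that[OF w]) blast
  qed
  have mem: "a \<in> conductor w" "b \<in> conductor w"
    using w(2) z ab by (auto simp: conductor_def)
  then have nz: "conductor w \<noteq> {0}" using ab \<open>x \<noteq> 0\<close> by auto
  have "primeideal (conductor w) as_ring" "prime_height as_ring (conductor w) = 1"
    by (rule maximal_conductor_height_one[OF nn w(1)], erule (1) max, rule nz)+
  then show False using mem ab(3) unfolding coprime_elems_def by blast
qed

lemma coprime_in_power:
  assumes "coprime_in S a b" "\<And>y. y \<in> S \<Longrightarrow> b * y \<in> S"
  shows "coprime_in S a (b ^ n)"
  unfolding coprime_in_def
proof (induction n)
  case (Suc n)
  show ?case
  proof (intro allI impI)
    fix y assume y: "a * y \<in> S" "b ^ Suc n * y \<in> S"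
    have "a * (b * y) \<in> S" using assms(2)[OF y(1)] by (simp add: mult_ac)
    moreover have "b ^ n * (b * y) \<in> S" using y(2) by (simp add: mult_ac)
    ultimately have "b * y \<in> S" using Suc by blast
    with y(1) show "y \<in> S" using assms(1) by (simp add: coprime_in_def)
  qed
qed simp

text \<open>Suppose a prime \<open>P\<close> of height 1 contains \<open>a\<close> and
  \<open>b\<close>. The localization at \<open>P\<close> has no primes besides zero and the
  extension of \<open>P\<close>, so inverting \<open>b\<close> as well leaves a field, in which
  \<open>a\<close> is a unit. This gives \<open>a r = b^n s\<close> with \<open>s\<close> outside
  \<open>P\<close>, and then \<open>s / a\<close> contradicts coprimality.\<close>

lemma coprime_in_imp_coprime_regular:
  fixes x y :: "'r::idom fract"
  assumes noeth: "noetherian_ring (as_ring :: 'r ring)"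
    and xy: "coprime_in (range to_fract) x y" "regular x" "regular y" "x \<noteq> 0"
  shows "coprime_regular x y"
proof -
  obtain a b where ab: "x = to_fract a" "y = to_fract b"
    using xy(2,3) by (auto simp: regular_def)
  have "coprime_elems as_ring a b"
    unfolding coprime_elems_def
  proof
    assume "\<exists>P. primeideal P as_ring \<and> prime_height as_ring P = 1 \<and> a \<in> P \<and> b \<in> P"
    then obtain P where P: "primeideal P as_ring" "prime_height as_ring P = 1"
      and aP: "a \<in> P" and bP: "b \<in> P" by blast
    have Pprime: "r \<in> P \<or> s \<in> P" if "r * s \<in> P" for r s
      using P(1) that by (auto simp: primeideal_as_ring_iff)
    have PI: "0 \<in> P" "1 \<notin> P" "\<And>r s. s \<in> P \<Longrightarrow> r * s \<in> P"
      using P(1) by (auto simp: primeideal_as_ring_iff ideal_as_ring_iff)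
    \<comment> \<open>The multiplicative set generated by \<open>b\<close> and the complement of
      \<open>P\<close>: a prime that avoids \<open>T\<close> lies in \<open>P\<close> and omits
      \<open>b\<close>, so it is zero because \<open>P\<close> has height 1.\<close>
    define T where "T = {b ^ n * s | n s. s \<notin> P}"
    have T1: "s \<in> T" if "s \<notin> P" for s
      unfolding T_def using that by (metis (mono_tags, lifting) mem_Collect_eq mult_1 power_0)
    have T2: "b * s \<in> T" if s: "s \<in> T" for s
    proof -
      obtain n t where "s = b ^ n * t" "t \<notin> P" using s by (auto simp: T_def)
      then have "b * s = b ^ Suc n * t" by (simp add: mult.assoc)
      with \<open>t \<notin> P\<close> show ?thesis unfolding T_def by blast
    qed
    have Tmult: "s * t \<in> T" if st: "s \<in> T" "t \<in> T" for s t
    proof -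
      obtain n m s' t' where eq: "s = b ^ n * s'" "t = b ^ m * t'" and "s' \<notin> P" "t' \<notin> P"
        using st by (auto simp: T_def)
      then have "s' * t' \<notin> P" using Pprime by blast
      moreover have "s * t = b ^ (n + m) * (s' * t')" by (simp add: eq power_add mult_ac)
      ultimately show ?thesis unfolding T_def by blast
    qed
    \<comment> \<open>Otherwise an ideal maximal among those that contain \<open>a\<close> and avoid \<open>T\<close> is a nonzero prime
      properly contained in \<open>P\<close>.\<close>
    have "\<exists>r. a * r \<in> T"
    proof (rule ccontr)
      assume no: "\<nexists>r. a * r \<in> T"
      define F where "F = {I. ideal I as_ring \<and> a \<in> I \<and> I \<inter> T = {}}"
      have "range (\<lambda>r. a * r) \<in> F"
      proof -
        have "ideal (range (\<lambda>r. a * r)) as_ring"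
          by (auto simp: ideal_as_ring_iff image_iff mult.left_commute
              simp flip: distrib_left)
        moreover have "a \<in> range (\<lambda>r. a * r)" by (rule range_eqI[of _ _ 1]) simp
        ultimately show ?thesis using no by (auto simp: F_def)
      qed
      then have "\<exists>M\<in>F. \<forall>I\<in>F. M \<subseteq> I \<longrightarrow> I = M"
        by (intro noetherian_ring.ex_maximal_ideal_in[OF noeth]) (blast, simp add: F_def)
      then obtain M where M: "M \<in> F" and max: "\<And>I. I \<in> F \<Longrightarrow> M \<subseteq> I \<Longrightarrow> I = M"
        by blast
      have MI: "0 \<in> M" "\<And>r s. r \<in> M \<Longrightarrow> s \<in> M \<Longrightarrow> r + s \<in> M" "\<And>r s. s \<in> M \<Longrightarrow> r * s \<in> M"
        and aM: "a \<in> M" and MT: "M \<inter> T = {}"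
        using M by (auto simp: F_def ideal_as_ring_iff)
      have meets: "\<exists>m\<in>M. \<exists>s. m + s * r \<in> T" if "r \<notin> M" for r
      proof (rule ccontr)
        assume none: "\<not> (\<exists>m\<in>M. \<exists>s. m + s * r \<in> T)"
        define I where "I = {m + s * r | m s. m \<in> M}"
        have "ideal I as_ring"
          unfolding ideal_as_ring_iff
        proof (intro conjI ballI allI)
          show "0 \<in> I" unfolding I_def using MI(1) by (auto intro!: exI[of _ 0])
        next
          fix x y assume "x \<in> I" "y \<in> I"
          then obtain m s m' s' where "x = m + s * r" "y = m' + s' * r" "m \<in> M" "m' \<in> M"
            by (auto simp: I_def)
          then have "x + y = (m + m') + (s + s') * r" "m + m' \<in> M"
            using MI(2) by (auto simp: algebra_simps)
          then show "x + y \<in> I" by (auto simp: I_def)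
        next
          fix x t assume "x \<in> I"
          then obtain m s where "x = m + s * r" "m \<in> M" by (auto simp: I_def)
          then have "t * x = t * m + (t * s) * r" "t * m \<in> M"
            using MI(3) by (auto simp: algebra_simps)
          then show "t * x \<in> I" unfolding I_def by blast
        qed
        moreover have sub: "M \<subseteq> I" unfolding I_def by clarsimp (metis add_0_right mult_zero_left)
        ultimately have "I \<in> F" using aM none by (auto simp: F_def I_def)
        with max sub have "I = M" by blast
        moreover have "r = 0 + 1 * r" by simp
        then have "r \<in> I" unfolding I_def using MI(1) by blast
        ultimately show False using that by simp
      qed
      have "primeideal M as_ring"
        unfolding primeideal_as_ring_iff
      proof (intro conjI allI impI)
        show "ideal M as_ring" using M by (simp add: F_def)
        show "1 \<notin> M" using MT T1[OF PI(2)] by blast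
        fix r s assume rs: "r * s \<in> M"
        show "r \<in> M \<or> s \<in> M"
        proof (rule ccontr)
          assume "\<not> (r \<in> M \<or> s \<in> M)"
          then obtain m t m' t' where m: "m \<in> M" "m' \<in> M" "m + t * r \<in> T" "m' + t' * s \<in> T"
            using meets by meson
          have "(m + t * r) * (m' + t' * s) = (m' + t' * s) * m + (t * r * m' + (t * t') * (r * s))"
            by (simp add: algebra_simps)
          also have "\<dots> \<in> M" by (intro MI(2,3) m rs)
          finally show False using Tmult[OF m(3,4)] MT by blast
        qed
      qed
      moreover have "M \<subseteq> P" using T1 MT by blast
      moreover have "b \<notin> M" using T2[OF T1[OF PI(2)]] MT by auto
      moreover have "M \<noteq> {0}" using aM ab xy(4) by auto
      ultimately show False
        using P bP by (auto simp: prime_height_eq_1_iff[OF P(1)])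
    qed
    then obtain r n s where rs: "a * r = b ^ n * s" "s \<notin> P" by (auto simp: T_def)
    \<comment> \<open>The fraction to test is \<open>s / x\<close>: its products with
      \<open>x\<close> and \<open>y ^ n\<close> are the images of \<open>s\<close> and
      \<open>r\<close>. Hence it lies in the domain, which makes \<open>s\<close> a multiple of
      \<open>a\<close> and puts it into \<open>P\<close>.\<close>
    have "coprime_in (range to_fract) x (y ^ n)"
      using xy by (intro coprime_in_power) (auto simp: regular_def simp flip: to_fract_mult)
    moreover have "x * (to_fract s / x) \<in> range to_fract" using xy(4) by simp
    moreover have "y ^ n * (to_fract s / x) = to_fract r"
    proof -
      have "y ^ n * to_fract s = x * to_fract r"
      proof -
        have "to_fract b ^ n = to_fract (b ^ n)" by (induction n) auto
        then show ?thesis using rs(1) ab by (simp flip: to_fract_mult)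
      qed
      then show ?thesis using xy(4) by (simp add: field_simps)
    qed
    ultimately obtain t where "to_fract s / x = to_fract t"
      unfolding coprime_in_def by (metis imageE rangeI)
    then have "to_fract s = to_fract (t * a)" using xy(4) ab by (simp add: field_simps)
    then have "s = t * a" by (simp del: to_fract_mult)
    then show False using PI(3)[OF aP] rs(2) by simp
  qed
  then show ?thesis using ab by (auto simp: coprime_regular_def)
qed

text \<open>The factors are absorbed into the test fraction one at a time. For infinite
  \<open>M\<close> the product is 1 by convention and the claim is trivial.\<close>

lemma coprime_in_prod:
  assumes S: "\<And>x y. x \<in> S \<Longrightarrow> y \<in> S \<Longrightarrow> x * y \<in> S"
    and M: "M \<subseteq> S" "\<And>m. m \<in> M \<Longrightarrow> coprime_in S a m"
  shows "coprime_in S a (\<Prod>M)"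
proof (cases "finite M")
  case True
  then show ?thesis using M
  proof (induction M)
    case (insert m M)
    show ?case
      unfolding coprime_in_def
    proof (intro allI impI)
      fix y assume y: "a * y \<in> S" "\<Prod>(insert m M) * y \<in> S"
      have "a * (m * y) \<in> S"
        using S[of m "a * y"] y(1) insert.prems by (simp add: mult.left_commute)
      moreover have "\<Prod>M * (m * y) \<in> S" using y(2) insert.hyps by (simp add: mult_ac)
      moreover have "coprime_in S a (\<Prod>M)" using insert by blast
      ultimately have "m * y \<in> S" unfolding coprime_in_def by blast
      with y(1) show "y \<in> S" using insert.prems(2)[of m] by (simp add: coprime_in_def)
    qed
  qed (simp add: coprime_in_def)
qed (simp add: coprime_in_def)

lemma coprime_in_mult_units:
  fixes S :: "'k::field set"
  assumes S: "\<And>x y. x \<in> S \<Longrightarrow> y \<in> S \<Longrightarrow> x * y \<in> S"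
    and "inverse u \<in> S" "u \<noteq> 0" "inverse v \<in> S" "v \<noteq> 0" "coprime_in S a b"
  shows "coprime_in S (a * u) (b * v)"
  unfolding coprime_in_def
proof (intro allI impI)
  fix y assume "a * u * y \<in> S" "b * v * y \<in> S"
  from S[OF assms(2) this(1)] S[OF assms(4) this(2)] have "a * y \<in> S" "b * y \<in> S"
    using assms(3,5) by (simp_all add: field_simps)
  with assms(6) show "y \<in> S" by (simp add: coprime_in_def)
qed

lemma range_to_fract_power: "x \<in> range to_fract \<Longrightarrow> x ^ n \<in> range to_fract"
  by (induction n) (auto intro: range_to_fract_closed)

lemma range_to_fract_prod:
  "(\<And>i. i \<in> A \<Longrightarrow> f i \<in> range to_fract) \<Longrightarrow> prod f A \<in> range to_fract"
  by (induction A rule: infinite_finite_induct) (auto intro: range_to_fract_closed)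

section \<open>Localization\<close>

lemma localize_closed:
  fixes A :: "'k::field set"
  shows "x \<in> A \<Longrightarrow> x \<in> localize A S"
    "s \<in> S \<Longrightarrow> inverse s \<in> localize A S"
    "1 \<in> localize A S"
    "x \<in> localize A S \<Longrightarrow> y \<in> localize A S \<Longrightarrow> x * y \<in> localize A S"
  using generate_ring.one[of as_ring "A \<union> inverse ` S"]
    generate_ring.incl[of _ "A \<union> inverse ` S" as_ring]
    generate_ring.eng_mult[of _ as_ring "A \<union> inverse ` S"]
  by (auto simp: localize_def)

lemma localize_prod:
  fixes A :: "'k::field set"
  shows "(\<And>i. i \<in> I \<Longrightarrow> f i \<in> localize A S) \<Longrightarrow> prod f I \<in> localize A S"
  by (induction I rule: infinite_finite_induct) (auto intro: localize_closed)

lemma localize_power: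
  fixes A :: "'k::field set"
  shows "x \<in> localize A S \<Longrightarrow> x ^ n \<in> localize A S"
  by (induction n) (auto intro: localize_closed)

lemma localize_denominator:
  fixes y :: "'r::idom fract"
  assumes "finite M" "M \<subseteq> range to_fract" "y \<in> localize (range to_fract) M"
  shows "\<exists>n. \<Prod>M ^ n * y \<in> range to_fract"
proof -
  have e: "\<Prod>M ^ n \<in> range to_fract" for n
    using assms(2) by (intro range_to_fract_power range_to_fract_prod) auto
  show "\<exists>n. \<Prod>M ^ n * y \<in> range to_fract"
    using assms(3) unfolding localize_def
  proof (induction y)
    case one
    show ?case using e by auto
  next
    case (incl y)
    then consider "y \<in> range to_fract" | m where "m \<in> M" "y = inverse m" by auto
    then show ?case
    proof cases
      case 1
      then show ?thesis by (intro exI[of _ 0]) simp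
    next
      case 2
      \<comment> \<open>The remaining factors of the product survive; for \<open>m = 0\<close> the
        convention \<open>inverse 0 = 0\<close> applies.\<close>
      then have "\<Prod>M * inverse m = (if m = 0 then 0 else \<Prod>(M - {m}))"
        using assms by (auto simp: prod.remove)
      moreover have "\<Prod>(M - {m}) \<in> range to_fract"
        using assms by (intro range_to_fract_prod) auto
      ultimately show ?thesis using 2 range_to_fract_closed(1) by (intro exI[of _ 1]) auto
    qed
  next
    case (a_inv y)
    then obtain n where "\<Prod>M ^ n * y \<in> range to_fract" by blast
    from range_to_fract_closed(5)[OF this] show ?case by (intro exI[of _ n]) simp
  next
    case (eng_add y z)
    then obtain n m where nm: "\<Prod>M ^ n * y \<in> range to_fract" "\<Prod>M ^ m * z \<in> range to_fract"
      by blast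
    have "\<Prod>M ^ (n + m) * (y + z) = \<Prod>M ^ m * (\<Prod>M ^ n * y) + \<Prod>M ^ n * (\<Prod>M ^ m * z)"
      by (simp add: power_add algebra_simps)
    also have "\<dots> \<in> range to_fract"
      by (intro range_to_fract_closed e nm)
    finally show ?case by (auto simp del: power_add)
  next
    case (eng_mult y z)
    then obtain n m where nm: "\<Prod>M ^ n * y \<in> range to_fract" "\<Prod>M ^ m * z \<in> range to_fract"
      by blast
    have "\<Prod>M ^ (n + m) * (y * z) = (\<Prod>M ^ n * y) * (\<Prod>M ^ m * z)"
      by (simp add: power_add mult_ac)
    also have "\<dots> \<in> range to_fract"
      by (intro range_to_fract_closed e nm)
    finally show ?case by auto
  qed
qed

lemma localize_iff:
  fixes y :: "'r::idom fract"
  assumes "finite M" "M \<subseteq> range to_fract" "0 \<notin> M"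
  shows "y \<in> localize (range to_fract) M \<longleftrightarrow> (\<exists>n. \<Prod>M ^ n * y \<in> range to_fract)"
proof
  assume "\<exists>n. \<Prod>M ^ n * y \<in> range to_fract"
  then obtain n where n: "\<Prod>M ^ n * y \<in> range to_fract" by blast
  have nz: "\<Prod>M \<noteq> 0" using assms by simp
  have "inverse (\<Prod>M) \<in> localize (range to_fract) M"
    unfolding prod_inversef[symmetric, of "\<lambda>x. x", simplified] o_def
    by (intro localize_prod localize_closed)
  then have "inverse (\<Prod>M) ^ n * (\<Prod>M ^ n * y) \<in> localize (range to_fract) M"
    by (rule localize_closed(4)[OF localize_power localize_closed(1)[OF n]])
  then show "y \<in> localize (range to_fract) M"
    using nz by (simp add: mult.assoc[symmetric] power_mult_distrib[symmetric])
qed (rule localize_denominator[OF assms(1,2)])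

text \<open>A common power of \<open>\<Prod>M\<close> clears the denominators of both
  \<open>a y\<close> and \<open>b y\<close>; coprimality is then applied to \<open>y\<close> times
  that power.\<close>

lemma coprime_in_localize:
  fixes a b :: "'r::idom fract"
  assumes M: "finite M" "M \<subseteq> range to_fract" "0 \<notin> M"
    and ab: "coprime_in (range to_fract) a b"
  shows "coprime_in (localize (range to_fract) M) a b"
  unfolding coprime_in_def localize_iff[OF M]
proof (intro allI impI)
  fix y assume "\<exists>n. \<Prod>M ^ n * (a * y) \<in> range to_fract" "\<exists>n. \<Prod>M ^ n * (b * y) \<in> range to_fract"
  then obtain n m
    where nm: "\<Prod>M ^ n * (a * y) \<in> range to_fract" "\<Prod>M ^ m * (b * y) \<in> range to_fract"
    by blast
  have e: "\<Prod>M ^ n \<in> range to_fract" for n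
    using M(2) by (intro range_to_fract_power range_to_fract_prod) auto
  have "a * (\<Prod>M ^ (n + m) * y) = \<Prod>M ^ m * (\<Prod>M ^ n * (a * y))"
    "b * (\<Prod>M ^ (n + m) * y) = \<Prod>M ^ n * (\<Prod>M ^ m * (b * y))"
    by (simp_all add: power_add mult_ac)
  then have "a * (\<Prod>M ^ (n + m) * y) \<in> range to_fract"
    "b * (\<Prod>M ^ (n + m) * y) \<in> range to_fract"
    using range_to_fract_closed(4)[OF e nm(1)] range_to_fract_closed(4)[OF e nm(2)] by (simp_all only:)
  with ab show "\<exists>n. \<Prod>M ^ n * y \<in> range to_fract" unfolding coprime_in_def by blast
qed

text \<open>\<open>y\<close> has two denominators, \<open>a\<close> and a power of
  \<open>\<Prod>M\<close>. They are coprime, so \<open>y\<close> needs no denominator.\<close>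

lemma regular_of_localize:
  fixes a y :: "'r::idom fract"
  assumes M: "finite M" "M \<subseteq> range to_fract"
    and "\<And>m. m \<in> M \<Longrightarrow> coprime_in (range to_fract) a m"
    and "y \<in> localize (range to_fract) M" "a * y \<in> range to_fract"
  shows "y \<in> range to_fract"
proof -
  obtain n where n: "\<Prod>M ^ n * y \<in> range to_fract"
    using localize_denominator[OF M assms(4)] by blast
  have "coprime_in (range to_fract) a (\<Prod>M ^ n)"
    using assms(2,3)
    by (intro coprime_in_power coprime_in_prod range_to_fract_closed(4) range_to_fract_prod) auto
  with n assms(5) show ?thesis by (simp add: coprime_in_def)
qed

lemma coprime_in_of_localize:
  fixes a b :: "'r::idom fract"
  assumes M: "finite M" "M \<subseteq> range to_fract"
    and a: "\<And>m. m \<in> M \<Longrightarrow> coprime_in (range to_fract) a m"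
    and ab: "coprime_in (localize (range to_fract) M) a b"
  shows "coprime_in (range to_fract) a b"
  unfolding coprime_in_def
proof (intro allI impI)
  fix y assume y: "a * y \<in> range to_fract" "b * y \<in> range to_fract"
  then have "y \<in> localize (range to_fract) M"
    using ab localize_closed(1) unfolding coprime_in_def by blast
  from regular_of_localize[OF M a this y(1)] show "y \<in> range to_fract" .
qed

lemma regular_of_localizations:
  fixes y :: "'r::idom fract"
  assumes M: "finite M" "M \<subseteq> range to_fract" "y \<in> localize (range to_fract) M"
    and ex: "\<And>x. x \<in> M \<Longrightarrow> \<exists>L. finite L \<and> L \<subseteq> range to_fract \<and>
      (\<forall>z\<in>L. coprime_in (range to_fract) x z) \<and> y \<in> localize (range to_fract) L"
  shows "y \<in> range to_fract"
proof -
  have "y \<in> range to_fract" if "F \<subseteq> M" "\<Prod>F ^ n * y \<in> range to_fract" for F n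
    using finite_subset[OF that(1) M(1)] that
  proof (induction F)
    case (insert x F)
    let ?y = "\<Prod>F ^ n * y"
    obtain L where L: "finite L" "L \<subseteq> range to_fract"
      and cop: "\<And>z. z \<in> L \<Longrightarrow> coprime_in (range to_fract) x z"
      and yL: "y \<in> localize (range to_fract) L"
      using ex[of x] insert.prems by blast
    have "\<Prod>F ^ n \<in> range to_fract"
      using insert.prems M by (intro range_to_fract_power range_to_fract_prod) auto
    then have yL': "?y \<in> localize (range to_fract) L"
      by (intro localize_closed(4) yL) (rule localize_closed)
    have "x ^ n * ?y \<in> range to_fract"
      using insert by (simp add: power_mult_distrib mult_ac)
    moreover have "coprime_in (range to_fract) (x ^ n) z" if "z \<in> L" for z
      using cop[OF that] insert.prems M coprime_in_power[of "range to_fract" z x n]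
      by (subst coprime_in_commute) (auto simp: coprime_in_commute intro: range_to_fract_closed(4))
    ultimately have "?y \<in> range to_fract"
      using regular_of_localize[OF L _ yL'] by blast
    with insert show ?case by simp
  qed simp
  with localize_denominator[OF M] show ?thesis by blast
qed

section \<open>Cluster structures\<close>

lemma alg_independent_nonzero:
  assumes "alg_independent I x" "i \<in> I"
  shows "x i \<noteq> 0"
proof
  assume "x i = 0"
  let ?p = "Poly_Mapping.single (Poly_Mapping.single i 1) 1 :: (nat \<Rightarrow>\<^sub>0 nat) \<Rightarrow>\<^sub>0 int"
  have "int_poly_eval x ?p = 0" using \<open>x i = 0\<close> by (simp add: int_poly_eval_def)
  moreover have "\<forall>m\<in>Poly_Mapping.keys ?p. Poly_Mapping.keys m \<subseteq> I" using assms(2) by simp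
  ultimately have "?p = 0" using assms(1) unfolding alg_independent_def by blast
  then show False by (metis lookup_single_eq lookup_zero zero_neq_one)
qed

lemma alg_independent_inj_on:
  assumes "alg_independent I x"
  shows "inj_on x I"
proof (rule inj_onI, rule ccontr)
  fix i j assume ij: "i \<in> I" "j \<in> I" "x i = x j" "i \<noteq> j"
  let ?m = "\<lambda>i. Poly_Mapping.single i 1 :: nat \<Rightarrow>\<^sub>0 nat"
  define p where "p = Poly_Mapping.single (?m i) 1 - (Poly_Mapping.single (?m j) 1 :: (nat \<Rightarrow>\<^sub>0 nat) \<Rightarrow>\<^sub>0 int)"
  have ne: "?m i \<noteq> ?m j" using ij(4) by (metis lookup_single_eq lookup_single_not_eq zero_neq_one)
  have look: "Poly_Mapping.lookup p m = (if m = ?m i then 1 else if m = ?m j then -1 else 0)" for m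
    using ne by (auto simp: p_def lookup_minus lookup_single when_def)
  have keys: "Poly_Mapping.keys p = {?m i, ?m j}"
    by (auto simp: in_keys_iff look split: if_splits)
  have "int_poly_eval x p = 0"
    using ne ij(3) unfolding int_poly_eval_def keys by (simp add: look)
  then have "p = 0" using assms ij keys by (auto simp: alg_independent_def)
  then show False using look[of "?m i"] by simp
qed

lemma coprime_regular_commute: "coprime_regular x y \<longleftrightarrow> coprime_regular y x"
  unfolding coprime_regular_def coprime_elems_def by blast

section \<open>Upper cluster algebras and the starfish lemma\<close>

lemma laurent_ring_subset_localize:
  fixes x :: "nat \<Rightarrow> 'r::idom fract"
  assumes "\<And>j. j \<in> {1..nvars C} \<Longrightarrow> x j \<in> range to_fract"
  shows "laurent_ring C x \<subseteq> localize (range to_fract) (x ` {1..rk C})"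
proof -
  interpret ring "as_ring :: 'r fract ring" by (rule ring_from_type_algebra)
  show ?thesis unfolding laurent_ring_def localize_def
    by (rule mono_generate_ring) (use assms in auto)
qed

text \<open>Membership in the Laurent rings of the initial cluster and of its neighbours, one for
  each mutation direction, suffices.\<close>

lemma starfish:
  fixes C :: "'r::idom fract cluster_str"
  assumes nn: "normal_domain TYPE('r)" "noetherian_ring (as_ring :: 'r ring)"
    and C: "cluster_structure C" "admissible C (init_ext_cluster C)"
  shows "upper_cluster_algebra C \<subseteq> range to_fract"
proof
  fix y assume y: "y \<in> upper_cluster_algebra C"
  let ?X = "vars (init C)"
  have reg: "?X j \<in> range to_fract" if "j \<in> {1..nvars C}" for j
    using C(2) that by (auto simp: admissible_def init_ext_cluster_def regular_def)
  have indep: "alg_independent {1..nvars C} ?X" using C(1) by (simp add: cluster_structure_def)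
  have nz: "?X j \<noteq> 0" if "j \<in> {1..nvars C}" for j
    using alg_independent_nonzero[OF indep that] .
  show "y \<in> range to_fract"
  proof (rule regular_of_localizations[where M = "?X ` {1..rk C}"])
    have "y \<in> laurent_ring C ?X"
      using y seeds.init by (auto simp: upper_cluster_algebra_def)
    then show "y \<in> localize (range to_fract) (?X ` {1..rk C})"
      using laurent_ring_subset_localize[of C ?X] reg by blast
  next
    fix x assume "x \<in> ?X ` {1..rk C}"
    then obtain k where k: "k \<in> {1..rk C}" "x = ?X k" by blast
    let ?x' = "mutated_var (nvars C) (init C) k"
    define Y where "Y = ?X(k := ?x')"
    have adm: "regular ?x'" "coprime_regular ?x' (?X k)"
      using C(2) k(1) by (auto simp: admissible_def init_ext_cluster_def)
    have Yreg: "Y j \<in> range to_fract" if "j \<in> {1..nvars C}" for j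
      using that adm reg by (auto simp: Y_def regular_def)
    have "mutation (nvars C) k (init C) \<in> seeds C"
      using k seeds.init seeds.mutate by blast
    then have "y \<in> laurent_ring C Y"
      using y by (auto simp: upper_cluster_algebra_def mutation_def Y_def)
    then have yY: "y \<in> localize (range to_fract) (Y ` {1..rk C})"
      using laurent_ring_subset_localize[of C Y] Yreg by blast
    show "\<exists>L. finite L \<and> L \<subseteq> range to_fract \<and>
      (\<forall>z\<in>L. coprime_in (range to_fract) x z) \<and> y \<in> localize (range to_fract) L"
    \<comment> \<open>The neighbouring cluster at \<open>k\<close> contains the mutation of
      \<open>x\<close> in place of \<open>x\<close>, so admissibility makes each of its cluster
      variables coprime to \<open>x\<close>.\<close>
    proof (intro exI[of _ "Y ` {1..rk C}"] conjI ballI)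
      fix z assume "z \<in> Y ` {1..rk C}"
      then obtain j where j: "j \<in> {1..rk C}" "z = Y j" by blast
      show "coprime_in (range to_fract) x z"
      proof (cases "j = k")
        case True
        then show ?thesis
          using coprime_regular_imp_coprime_in[OF nn, of x ?x'] adm(2) k j nz[of k]
          by (simp add: Y_def coprime_regular_commute[of ?x'])
      next
        case False
        \<comment> \<open>Admissibility speaks of distinct elements; algebraic independence makes
          variables with distinct indices distinct.\<close>
        then have "?X k \<noteq> ?X j"
          using alg_independent_inj_on[OF indep] j(1) k(1) by (auto dest!: inj_onD)
        then have "coprime_regular (?X k) (?X j)"
          using C(2) j(1) k(1) by (auto simp: admissible_def init_ext_cluster_def init_cluster_vars_def)
        then show ?thesis
          using coprime_regular_imp_coprime_in[OF nn] nz[of k] j k False by (simp add: Y_def)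
      qed
    qed (use Yreg yY in auto)
  qed (use reg in auto)
qed

section \<open>Transport along isomorphisms and the ambient field\<close>

lemma coprime_in_iso:
  assumes \<psi>: "inj \<psi>" "\<And>x y. \<psi> (x * y) = \<psi> x * \<psi> y" "\<psi> ` S = S'"
    and ab: "coprime_in S' (\<psi> a) (\<psi> b)"
  shows "coprime_in S a b"
  unfolding coprime_in_def
proof (intro allI impI)
  fix y assume "a * y \<in> S" "b * y \<in> S"
  then have "\<psi> (a * y) \<in> \<psi> ` S" "\<psi> (b * y) \<in> \<psi> ` S" by blast+
  then have "\<psi> a * \<psi> y \<in> S'" "\<psi> b * \<psi> y \<in> S'" by (simp_all only: \<psi>(2,3))
  then have "\<psi> y \<in> S'" using ab unfolding coprime_in_def by blast
  then show "y \<in> S" using inj_image_mem_iff[OF \<psi>(1), of y S] by (simp add: \<psi>(3))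
qed

lemma localize_power_int:
  fixes A :: "'k::field set"
  assumes "s \<in> S" "S \<subseteq> A"
  shows "s powi l \<in> localize A S"
  using localize_power[OF localize_closed(1)[of s A S]] localize_power[OF localize_closed(2)[of s S A]]
    assms by (auto simp: power_int_def)

lemma generate_field_prod:
  fixes H :: "'k::field set"
  shows "(\<And>i. i \<in> A \<Longrightarrow> f i \<in> generate_field as_ring H) \<Longrightarrow> prod f A \<in> generate_field as_ring H"
proof (induction A rule: infinite_finite_induct)
  case (insert a A)
  then have "f a \<otimes>\<^bsub>as_ring\<^esub> prod f A \<in> generate_field as_ring H"
    by (intro generate_field.eng_mult) auto
  then show ?case using insert by simp
qed (use generate_field.one[of as_ring H] in auto)

lemma generate_field_power:
  fixes H :: "'k::field set"
  shows "x \<in> generate_field as_ring H \<Longrightarrow> x ^ n \<in> generate_field as_ring H"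
  using generate_field_prod[of "{..<n}" "\<lambda>_. x"] by simp

text \<open>Used to replace \<open>\<psi>\<close> by \<open>Q\<close> at a mutated variable, since
  the two are known to agree only on the ambient field.\<close>

lemma mutated_var_in_ambient_field:
  assumes "k \<in> {1..nvars C}" "vars (init C) k \<noteq> 0"
  shows "mutated_var (nvars C) (init C) k \<in> ambient_field C"
proof -
  let ?K = "generate_field as_ring (vars (init C) ` {1..nvars C})"
  have incl: "vars (init C) j \<in> ?K" if "j \<in> {1..nvars C}" for j
    using that by (intro generate_field.incl) auto
  have add: "a + b \<in> ?K" if "a \<in> ?K" "b \<in> ?K" for a b
    using generate_field.eng_add[OF that] by simp
  have divide: "a / b \<in> ?K" if "a \<in> ?K" "b \<in> ?K" "b \<noteq> 0" for a b
    using generate_field.eng_mult[OF that(1) generate_field.m_inv[OF that(2)]] that(3)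
    by (simp add: m_inv_as_ring divide_inverse)
  show ?thesis unfolding ambient_field_def mutated_var_def
    by (intro divide add generate_field_prod generate_field_power incl assms) auto
qed

text \<open>The right-hand side of the exchange relation is a polynomial in regular variables. So
  the variable itself is a denominator of its mutation, to be played off against the marked
  variables.\<close>

lemma var_mult_mutated_var_regular:
  fixes C :: "'r::idom fract cluster_str"
  assumes "\<And>j. j \<in> {1..nvars C} \<Longrightarrow> vars (init C) j \<in> range to_fract"
    and "vars (init C) k \<noteq> 0"
  shows "vars (init C) k * mutated_var (nvars C) (init C) k \<in> range to_fract"
proof -
  have "vars (init C) k * mutated_var (nvars C) (init C) k =
    (\<Prod>j \<in> {j \<in> {1..nvars C}. mat (init C) k j > 0}. vars (init C) j ^ nat (mat (init C) k j)) +
    (\<Prod>j \<in> {j \<in> {1..nvars C}. mat (init C) k j < 0}. vars (init C) j ^ nat (- mat (init C) k j))"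
    unfolding mutated_var_def times_divide_eq_right by (rule nonzero_mult_div_cancel_left[OF assms(2)])
  also have "\<dots> \<in> range to_fract"
    by (intro range_to_fract_closed(3) range_to_fract_prod range_to_fract_power assms(1)) auto
  finally show ?thesis .
qed

section \<open>Transfer of admissibility between the two cluster structures\<close>

theorem proposition4p2:
  fixes C :: "'r::idom fract cluster_str"
    and C' :: "'s::idom fract cluster_str"
    and \<kappa> :: "nat \<Rightarrow> nat"
    and Q :: "'r fract \<Rightarrow> 's fract"
  assumes "normal_domain TYPE('r)" and "noetherian_domain (as_ring :: 'r ring)"
    and "normal_domain TYPE('s)" and "noetherian_domain (as_ring :: 's ring)"
    and "cluster_structure C" and "cluster_structure C'"
    and "related_triple C C' \<kappa>"
    and "quasi_isomorphism C C' \<kappa> Q" and "birational C C' \<kappa> Q"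
    and "admissible C' (init_ext_cluster C')"
    and "admissible C (marked_vars C C' \<kappa>)"
    and "\<forall>x \<in> init_ext_cluster C. regular x"
    and "\<forall>x \<in> init_cluster_vars C - marked_vars C C' \<kappa>. \<forall>y \<in> marked_vars C C' \<kappa>.
           coprime_regular x y"
  shows "admissible C (init_ext_cluster C) \<and>
         upper_cluster_algebra C' \<subseteq> range to_fract \<and>
         upper_cluster_algebra C \<subseteq> range to_fract"
proof -
  note nR = assms(1) noetherian_domain.axioms(1)[OF assms(2)]
  note nR' = assms(3) noetherian_domain.axioms(1)[OF assms(4)]
  let ?X = "vars (init C)" and ?X' = "vars (init C')"
  let ?mut = "mutated_var (nvars C) (init C)" and ?mut' = "mutated_var (nvars C') (init C')"
  define J where "J = marked_indices C C' \<kappa>"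
  define M where "M = marked_vars C C' \<kappa>"
  define M' where "M' = marked_vars' C C' \<kappa>"
  let ?S = "localize (range to_fract) M" and ?S' = "localize (range to_fract) M'"
  have triple: "rk C' < rk C" "nvars C = nvars C'" "bij_betw \<kappa> {1..nvars C} {1..nvars C}"
    using assms(7) by (auto simp: related_triple_def)
  have inj: "inj_on \<kappa> {1..nvars C}" using triple(3) by (simp add: bij_betw_def)
  have \<kappa>: "\<kappa> i \<in> {1..nvars C'}" if "i \<in> {1..nvars C}" for i
    using bij_betwE[OF triple(3)] that triple(2) by auto
  have M_def': "M = ?X ` J" by (simp add: M_def J_def marked_vars_def)
  \<comment> \<open>Marked indices are defined through their images under \<open>\<kappa>\<close>;
    injectivity of \<open>\<kappa>\<close> brings them back to cluster indices.\<close>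
  have J_sub: "J \<subseteq> {1..rk C}"
  proof
    fix j assume "j \<in> J"
    then obtain i where "j \<in> {1..nvars C}" "i \<in> {1..rk C}" "\<kappa> j = \<kappa> i"
      by (auto simp: J_def marked_indices_def marked_indices'_def)
    moreover from this have "j = i" using inj_onD[OF inj, of j i] by simp
    ultimately show "j \<in> {1..rk C}" by simp
  qed
  have J_mark: "?X' (\<kappa> j) \<in> M'" "\<kappa> j \<in> {rk C' + 1..nvars C'}" if "j \<in> J" for j
    using that by (auto simp: J_def M'_def marked_vars'_def marked_indices_def marked_indices'_def)
  \<comment> \<open>A nonmarked cluster variable of \<open>C\<close> corresponds to a cluster
    variable of \<open>C'\<close>, since a frozen image would make the index marked.\<close>
  have nonmarked: "\<kappa> i \<in> {1..rk C'}" if "i \<in> {1..rk C} - J" for i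
  proof (rule ccontr)
    assume "\<kappa> i \<notin> {1..rk C'}"
    with that \<kappa>[of i] have "i \<in> J"
      by (auto simp: J_def marked_indices_def marked_indices'_def)
    with that show False by simp
  qed
  have indep: "alg_independent {1..nvars C} ?X" "alg_independent {1..nvars C'} ?X'"
    using assms(5,6) by (simp_all add: cluster_structure_def)
  have nz: "?X j \<noteq> 0" if "j \<in> {1..nvars C}" for j
    using alg_independent_nonzero[OF indep(1) that] .
  have nz': "?X' j \<noteq> 0" if "j \<in> {1..nvars C'}" for j
    using alg_independent_nonzero[OF indep(2) that] .
  have reg: "?X j \<in> range to_fract" if "j \<in> {1..nvars C}" for j
    using assms(12) that by (auto simp: init_ext_cluster_def regular_def)
  have "J \<subseteq> {1..nvars C}" using J_sub by auto
  then have nzJ: "?X j \<noteq> 0" and regJ: "?X j \<in> range to_fract" if "j \<in> J" for j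
    using that nz reg by blast+
  have M: "finite M" "M \<subseteq> range to_fract" "0 \<notin> M"
  proof -
    show "finite M" using finite_subset[OF J_sub] by (simp add: M_def')
    show "M \<subseteq> range to_fract" unfolding M_def' by (rule image_subsetI) (rule regJ)
    show "0 \<notin> M" using nzJ by (auto simp: M_def')
  qed
  have M': "finite M'" "M' \<subseteq> range to_fract" "0 \<notin> M'"
    using assms(9) nz'
    by (auto simp: birational_def regular_def M'_def marked_vars'_def marked_indices'_def)
  obtain \<phi> \<psi> where
    \<phi>: "\<phi> \<in> ring_iso (as_subring ?S) (as_subring ?S')"
    and \<psi>: "\<psi> \<in> ring_iso (as_ring :: 'r fract ring) (as_ring :: 's fract ring)"
    and \<phi>\<psi>: "\<And>a. a \<in> ?S \<Longrightarrow> \<psi> a = \<phi> a"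
    and Q\<psi>: "\<And>a. a \<in> ambient_field C \<Longrightarrow> \<psi> a = Q a"
    using assms(9) unfolding birational_def M_def M'_def by blast
  have \<psi>_mult: "\<psi> (a * b) = \<psi> a * \<psi> b" for a b
    using \<psi> by (simp add: ring_iso_def ring_hom_def)
  have \<psi>_inj: "inj \<psi>" using \<psi> by (simp add: ring_iso_def bij_betw_def)
  have \<psi>S: "\<psi> ` ?S = ?S'"
    using \<phi> \<phi>\<psi> by (auto simp: ring_iso_def bij_betw_def)
  \<comment> \<open>Coprimality in the second domain passes to its localization, absorbs the units
    \<open>u\<close> and \<open>v\<close>, and is pulled back along \<open>\<psi>\<close>.\<close>
  have transfer: "coprime_in ?S a b"
    if "\<psi> a = a' * u" "\<psi> b = b' * v" "coprime_in (range to_fract) a' b'"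
      "inverse u \<in> ?S'" "u \<noteq> 0" "inverse v \<in> ?S'" "v \<noteq> 0" for a b a' b' u v
    using that coprime_in_mult_units[OF localize_closed(4) that(4-7) coprime_in_localize[OF M' that(3)]]
    by (intro coprime_in_iso[OF \<psi>_inj \<psi>_mult \<psi>S]) simp
  \<comment> \<open>These are the factors in a quasi-isomorphism; they are units because the related
    marked variables are inverted in \<open>?S'\<close>.\<close>
  have monomial: "u \<in> ?S'" "inverse u \<in> ?S'" "u \<noteq> 0"
    if "u = (\<Prod>j\<in>J. ?X' (\<kappa> j) powi l j)" for u l
  proof -
    show "u \<in> ?S'" unfolding that
      by (intro localize_prod localize_power_int J_mark M'(2))
    have "inverse u = (\<Prod>j\<in>J. ?X' (\<kappa> j) powi (- l j))"
      unfolding that by (simp add: power_int_minus prod_inversef[symmetric] o_def)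
    also have "\<dots> \<in> ?S'"
      by (intro localize_prod localize_power_int J_mark M'(2))
    finally show "inverse u \<in> ?S'" .
    show "u \<noteq> 0" unfolding that using J_mark(2) nz' finite_subset[OF J_sub] by fastforce
  qed
  have quasi: "\<exists>l. Q (vars \<Sigma> i) = vars \<Sigma>' (\<kappa> i) * (\<Prod>j\<in>J. vars \<Sigma>' (\<kappa> j) powi l j)"
    if "related_seeds C C' \<kappa> \<Sigma> \<Sigma>'" "i \<in> {1..nvars C}" "i \<notin> J" for \<Sigma> \<Sigma>' i
    using assms(8) that unfolding quasi_isomorphism_def J_def by fastforce
  have \<psi>_var: "\<exists>u. \<psi> (?X i) = ?X' (\<kappa> i) * u \<and> u \<in> ?S' \<and> inverse u \<in> ?S' \<and> u \<noteq> 0"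
    if i: "i \<in> {1..rk C} - J" for i
  proof -
    have "i \<in> {1..nvars C}" using i by auto
    moreover from this have "\<psi> (?X i) = Q (?X i)"
      by (intro Q\<psi>) (auto simp: ambient_field_def intro!: generate_field.incl)
    ultimately show ?thesis
      using quasi[OF related_seeds.init, of i] i monomial by (metis DiffD2)
  qed
  have \<psi>_mut: "\<exists>u. \<psi> (?mut i) = ?mut' (\<kappa> i) * u \<and> u \<in> ?S' \<and> inverse u \<in> ?S' \<and> u \<noteq> 0"
    if i: "i \<in> {1..rk C} - J" for i
  proof -
    let ?\<Sigma> = "mutation (nvars C) i (init C)" and ?\<Sigma>' = "mutation (nvars C') (\<kappa> i) (init C')"
    have iC: "i \<in> {1..nvars C}" using i by auto
    have "related_seeds C C' \<kappa> ?\<Sigma> ?\<Sigma>'"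
      using i related_seeds.mutate[OF related_seeds.init] by (simp add: J_def)
    from quasi[OF this iC] i obtain l where
      "Q (vars ?\<Sigma> i) = vars ?\<Sigma>' (\<kappa> i) * (\<Prod>j\<in>J. vars ?\<Sigma>' (\<kappa> j) powi l j)" by blast
    moreover have "vars ?\<Sigma> i = ?mut i" "vars ?\<Sigma>' (\<kappa> i) = ?mut' (\<kappa> i)"
      by (simp_all add: mutation_def)
    \<comment> \<open>Mutation changes only the cluster variable at \<open>\<kappa> i\<close>, while
      the marked variables are frozen in \<open>C'\<close>.\<close>
    moreover have "vars ?\<Sigma>' (\<kappa> j) = ?X' (\<kappa> j)" if "j \<in> J" for j
      using J_mark(2)[OF that] nonmarked[OF i] by (auto simp: mutation_def)
    moreover have "\<psi> (?mut i) = Q (?mut i)"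
      by (intro Q\<psi> mutated_var_in_ambient_field iC nz)
    ultimately have "\<psi> (?mut i) = ?mut' (\<kappa> i) * (\<Prod>j\<in>J. ?X' (\<kappa> j) powi l j)" by simp
    with monomial[OF refl, of l] show ?thesis by blast
  qed
  have mut': "regular (?mut' k)" "coprime_in (range to_fract) (?mut' k) (?X' k)"
    if "k \<in> {1..rk C'}" for k
  proof -
    have "?X' k \<in> init_ext_cluster C'" using that by (auto simp: init_ext_cluster_def)
    then have "regular (?mut' k)" "coprime_regular (?mut' k) (?X' k)"
      using assms(10) that by (auto simp: admissible_def)
    then show "regular (?mut' k)" "coprime_in (range to_fract) (?mut' k) (?X' k)"
      using coprime_regular_imp_coprime_in[OF nR', of "?X' k" "?mut' k"] nz'[of k] that
      by (auto simp: coprime_regular_commute coprime_in_commute)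
  qed
  have marked_coprime: "coprime_in (range to_fract) (?X i) m" if "i \<in> {1..rk C} - J" "m \<in> M" for i m
  proof -
    have "?X i \<notin> M"
    proof
      assume "?X i \<in> M"
      then obtain j where j: "j \<in> J" "?X i = ?X j" by (auto simp: M_def')
      then have "i = j"
        using inj_onD[OF alg_independent_inj_on[OF indep(1)], of i j] that(1) J_sub by fastforce
      with j that(1) show False by simp
    qed
    then have "coprime_regular (?X i) m"
      using assms(13) that by (auto simp: M_def init_cluster_vars_def)
    then show ?thesis using coprime_regular_imp_coprime_in[OF nR] nz[of i] that(1) by auto
  qed
  have vars_coprime: "coprime_regular (?X i) (?X j)"
    if ij: "i \<in> {1..rk C} - J" "j \<in> {1..rk C} - J" "i \<noteq> j" for i j
  proof -
    obtain u v where u: "\<psi> (?X i) = ?X' (\<kappa> i) * u" "inverse u \<in> ?S'" "u \<noteq> 0"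
      and v: "\<psi> (?X j) = ?X' (\<kappa> j) * v" "inverse v \<in> ?S'" "v \<noteq> 0"
      using \<psi>_var[OF ij(1)] \<psi>_var[OF ij(2)] by blast
    have "\<kappa> i \<noteq> \<kappa> j" using that inj_on_contraD[OF inj, of i j] by simp
    moreover note \<kappa>ij = nonmarked[OF that(1)] nonmarked[OF that(2)]
    ultimately have "?X' (\<kappa> i) \<noteq> ?X' (\<kappa> j)"
      using inj_onD[OF alg_independent_inj_on[OF indep(2)], of "\<kappa> i" "\<kappa> j"] by auto
    then have "coprime_regular (?X' (\<kappa> i)) (?X' (\<kappa> j))"
      using assms(10) \<kappa>ij by (auto simp: admissible_def init_ext_cluster_def init_cluster_vars_def)
    then have "coprime_in (range to_fract) (?X' (\<kappa> i)) (?X' (\<kappa> j))"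
      using coprime_regular_imp_coprime_in[OF nR'] nz' \<kappa>ij by auto
    \<comment> \<open>Coprimality in the localization \<open>?S\<close> descends to the domain
      because \<open>?X i\<close> is coprime to every inverted element.\<close>
    from transfer[OF u(1) v(1) this u(2,3) v(2,3)]
    have "coprime_in (range to_fract) (?X i) (?X j)"
      by (rule coprime_in_of_localize[OF M(1,2), rotated]) (rule marked_coprime[OF ij(1)])
    then show ?thesis
      using coprime_in_imp_coprime_regular[OF nR(2)] reg nz that by (auto simp: regular_def)
  qed
  have mut: "regular (?mut i)" "coprime_regular (?mut i) (?X i)" if i: "i \<in> {1..rk C} - J" for i
  proof -
    have iC: "i \<in> {1..nvars C}" using i by auto
    obtain u where u: "\<psi> (?X i) = ?X' (\<kappa> i) * u" "inverse u \<in> ?S'" "u \<noteq> 0"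
      using \<psi>_var[OF i] by blast
    obtain v where v: "\<psi> (?mut i) = ?mut' (\<kappa> i) * v" "v \<in> ?S'" "inverse v \<in> ?S'" "v \<noteq> 0"
      using \<psi>_mut[OF i] by blast
    have m: "regular (?mut' (\<kappa> i))" "coprime_in (range to_fract) (?mut' (\<kappa> i)) (?X' (\<kappa> i))"
      using mut' nonmarked[OF i] by auto
    have "\<psi> (?mut i) \<in> ?S'"
      unfolding v(1) by (rule localize_closed(4)[OF localize_closed(1) v(2)])
        (use m(1) in \<open>simp add: regular_def\<close>)
    then have "?mut i \<in> ?S" using inj_image_mem_iff[OF \<psi>_inj, of _ ?S] by (simp add: \<psi>S)
    \<comment> \<open>In \<open>?S\<close> the mutation has only marked variables as denominators.
      These are coprime to \<open>?X i\<close>, which is a denominator too by the exchange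
      relation.\<close>
    then show r: "regular (?mut i)" unfolding regular_def
      by (rule regular_of_localize[OF M(1,2), rotated])
        (rule marked_coprime[OF i] var_mult_mutated_var_regular reg nz iC; assumption?)+
    have "coprime_in ?S (?X i) (?mut i)"
      using transfer[OF v(1) u(1) m(2) v(3,4) u(2,3)] by (simp add: coprime_in_commute)
    then have "coprime_in (range to_fract) (?X i) (?mut i)"
      by (rule coprime_in_of_localize[OF M(1,2), rotated]) (rule marked_coprime[OF i])
    then show "coprime_regular (?mut i) (?X i)"
      using coprime_in_imp_coprime_regular[OF nR(2)] r reg[OF iC] nz[OF iC]
      by (simp add: regular_def coprime_regular_commute)
  qed
  have "admissible C (init_ext_cluster C)"
    unfolding admissible_def
  proof (intro conjI ballI impI)
    show "regular x" if "x \<in> init_ext_cluster C" for x using assms(12) that by blast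
  next
    fix x y
    assume "x \<in> init_ext_cluster C \<inter> init_cluster_vars C"
      "y \<in> init_ext_cluster C \<inter> init_cluster_vars C" and "x \<noteq> y"
    then have xy: "x \<in> init_cluster_vars C" "y \<in> init_cluster_vars C" by auto
    \<comment> \<open>Two marked variables are coprime by admissibility of the marked set, mixed
      pairs by hypothesis, and two nonmarked ones by transfer from \<open>C'\<close>.\<close>
    consider "x \<in> M" "y \<in> M" | "x \<notin> M" "y \<in> M" | "x \<in> M" "y \<notin> M"
      | "x \<notin> M" "y \<notin> M" by blast
    then show "coprime_regular x y"
    proof cases
      case 1
      then show ?thesis using assms(11) xy \<open>x \<noteq> y\<close> by (auto simp: admissible_def M_def)
    next
      case 2
      then show ?thesis using assms(13) xy by (auto simp: M_def)
    next
      case 3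
      then show ?thesis using assms(13) xy coprime_regular_commute[of x y] by (auto simp: M_def)
    next
      case 4
      obtain i j where "i \<in> {1..rk C}" "j \<in> {1..rk C}" "x = ?X i" "y = ?X j"
        using xy by (auto simp: init_cluster_vars_def)
      with 4 \<open>x \<noteq> y\<close> show ?thesis using vars_coprime[of i j] by (auto simp: M_def')
    qed
  next
    fix i assume i: "i \<in> {1..rk C}"
    have "regular (?mut i) \<and> coprime_regular (?mut i) (?X i)"
    proof (cases "i \<in> J")
      case True
      then show ?thesis using assms(11) i by (auto simp: admissible_def M_def'[unfolded M_def])
    qed (use mut i in auto)
    then show "regular (?mut i)" "coprime_regular (?mut i) (?X i)" by auto
  qed simp
  with starfish[OF nR assms(5)] starfish[OF nR' assms(6,10)] show ?thesis by blast
qed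

end
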